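(* Let $d>0$, let $w$ be a weight function on $\mathcal{D}_d$, and let $K$, $Q$, $F^{\mathrm{C}}_{K,Q}(n)$ and $F^{\mathrm{D}}_{K,Q}(n)$ be as defined in the context. Then for every integer $n\ge 2$, $$\frac{F^{\mathrm{D}}_{K,Q}(n)}{n-1}\;\le\;\frac{F^{\mathrm{C}}_{K,Q}(n)}{n}\;\le\;\frac{n}{n-1}\left(\frac{2F^{\mathrm{D}}_{K,Q}(n)}{n-1}+(3+\log 2)\right).$$
   Context: Let $d>0$ and $\mathcal{D}_d:=\{z\in\mathbb{C}\mid |\mathrm{Im}\,z|<d\}$. A weight function is a function $w:\mathcal{D}_d\to\mathbb{C}$ satisfying: (1) $w$ is analytic and does not vanish on $\mathcal{D}_d$, and takes values in $(0,1]$ on $\mathbb{R}$; (2) $\lim_{x\to\pm\infty}\int_{-d}^{d}|w(x+iy)|\,\mathrm{d}y=0$ and $\lim_{y\nearrow d}\int_{-\infty}^{\infty}(|w(x+iy)|+|w(x-iy)|)\,\mathrm{d}x<\infty$; (3) $\log w$ is strictly concave on $\mathbb{R}$. For $x\in\mathbb{R}$ define $$K(x):=-\log\left|\tanh\left(\frac{\pi}{4d}x\right)\right|\in[0,\infty]\quad(K(0)=+\infty),\qquad Q(x):=-\log w(x).$$ Let $\mathcal{M}(\mathbb{R},n)$ be the set of all (positive) Borel measures $\mu$ on $\mathbb{R}$ with $\mu(\mathbb{R})=n$. The continuous energy of $\mu\in\mathcal{M}(\mathbb{R},n)$ is $$I_n^{\mathrm{C}}(\mu):=\int_{\mathbb{R}}\int_{\mathbb{R}}K(x-y)\,\mathrm{d}\mu(x)\,\mathrm{d}\mu(y)+2\int_{\mathbb{R}}Q(x)\,\mathrm{d}\mu(x).$$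 It is known that $I_n^{\mathrm{C}}$ has a unique minimizer $\mu_n^*$ over $\mathcal{M}(\mathbb{R},n)$, and that it has compact support. Define $$F^{\mathrm{C}}_{K,Q}(n):=I_n^{\mathrm{C}}(\mu_n^* )-\int_{\mathbb{R}}Q(x)\,\mathrm{d}\mu_n^*(x)=\int_{\mathbb{R}}\int_{\mathbb{R}}K(x-y)\,\mathrm{d}\mu_n^*(x)\,\mathrm{d}\mu_n^*(y)+\int_{\mathbb{R}}Q(x)\,\mathrm{d}\mu_n^*(x).$$ For real $a=(a_1,\dots,a_n)$ with $a_1<\cdots<a_n$, the discrete energy is $$I^{\mathrm{D}}_{K,Q}(a):=\sum_{i\ne j}K(a_i-a_j)+\frac{2(n-1)}{n}\sum_{i=1}^nQ(a_i),$$ where the first sum is over ordered pairs $(i,j)$, $1\le i,j\le n$, $i\neq j$. It is known that $I^{\mathrm{D}}_{K,Q}$ has a unique minimizer $a^*=(a_1^*,\dots,a_n^* )$ over such tuples. Define $$F^{\mathrm{D}}_{K,Q}(n):=I^{\mathrm{D}}_{K,Q}(a^* )-\frac{n-1}{n}\sum_{i=1}^nQ(a_i^* ).$$ *)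

theory Defs
  imports "HOL-Analysis.Analysis"
begin

definition strip :: "real \<Rightarrow> complex set" where
  "strip d = {z. \<bar>Im z\<bar> < d}"

definition strictly_concave_on :: "real set \<Rightarrow> (real \<Rightarrow> real) \<Rightarrow> bool" where
  "strictly_concave_on S f \<longleftrightarrow> convex S \<and>
     (\<forall>x\<in>S. \<forall>y\<in>S. \<forall>t. x \<noteq> y \<longrightarrow> 0 < t \<longrightarrow> t < 1 \<longrightarrow>
        (1 - t) * f x + t * f y < f ((1 - t) * x + t * y))"

(* Only the values of w on the strip matter. The integrals are taken in [0,\<infinity>], so that
   the limits below also say that the integrals are eventually finite. *)
definition weight_function :: "real \<Rightarrow> (complex \<Rightarrow> complex) \<Rightarrow> bool" where
  "weight_function d w \<longleftrightarrow>
     w analytic_on strip d \<and>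
     (\<forall>z\<in>strip d. w z \<noteq> 0) \<and>
     (\<forall>x::real. w (of_real x) \<in> of_real ` {0<..1::real}) \<and>
     ((\<lambda>x. \<integral>\<^sup>+y\<in>{-d<..<d}. ennreal (norm (w (Complex x y))) \<partial>lborel) \<longlongrightarrow> 0) at_top \<and>
     ((\<lambda>x. \<integral>\<^sup>+y\<in>{-d<..<d}. ennreal (norm (w (Complex x y))) \<partial>lborel) \<longlongrightarrow> 0) at_bot \<and>
     (\<exists>L::ennreal. L < \<infinity> \<and>
        ((\<lambda>y. \<integral>\<^sup>+x. ennreal (norm (w (Complex x y)) + norm (w (Complex x (-y)))) \<partial>lborel)
           \<longlongrightarrow> L) (at_left d)) \<and>
     strictly_concave_on UNIV (\<lambda>x. ln (Re (w (of_real x))))"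

(* The value at 0 has to be given separately because ln 0 = 0 in HOL. Elsewhere
   0 < \<bar>tanh\<bar> < 1, so ennreal does not truncate. *)
definition K :: "real \<Rightarrow> real \<Rightarrow> ennreal" where
  "K d x = (if x = 0 then \<infinity> else ennreal (- ln \<bar>tanh (pi / (4 * d) * x)\<bar>))"

(* Nonnegative for a weight function, since then 0 < w \<le> 1 on the real line; hence
   ennreal (Q w x) below is Q w x itself. *)
definition Q :: "(complex \<Rightarrow> complex) \<Rightarrow> real \<Rightarrow> real" where
  "Q w x = - ln (Re (w (of_real x)))"

definition borel_measures :: "nat \<Rightarrow> real measure set" where
  "borel_measures n = {\<mu>. sets \<mu> = sets borel \<and> emeasure \<mu> (space \<mu>) = of_nat n}"

definition energy_C :: "real \<Rightarrow> (complex \<Rightarrow> complex) \<Rightarrow> real measure \<Rightarrow> ennreal" where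
  "energy_C d w \<mu> =
     (\<integral>\<^sup>+y. (\<integral>\<^sup>+x. K d (x - y) \<partial>\<mu>) \<partial>\<mu>) + 2 * (\<integral>\<^sup>+x. ennreal (Q w x) \<partial>\<mu>)"

definition minimizer_C :: "real \<Rightarrow> (complex \<Rightarrow> complex) \<Rightarrow> nat \<Rightarrow> real measure" where
  "minimizer_C d w n = arg_min (energy_C d w) (\<lambda>\<mu>. \<mu> \<in> borel_measures n)"

(* Subtraction on ennreal is truncated, but here (and in F_D) the subtrahend is half of
   one of the two nonnegative summands of the energy. *)
definition F_C :: "real \<Rightarrow> (complex \<Rightarrow> complex) \<Rightarrow> nat \<Rightarrow> ennreal" where
  "F_C d w n =
     energy_C d w (minimizer_C d w n) - (\<integral>\<^sup>+x. ennreal (Q w x) \<partial>(minimizer_C d w n))"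

definition increasing_tuples :: "nat \<Rightarrow> real list set" where
  "increasing_tuples n = {a. length a = n \<and> sorted_wrt (<) a}"

definition energy_D :: "real \<Rightarrow> (complex \<Rightarrow> complex) \<Rightarrow> nat \<Rightarrow> real list \<Rightarrow> ennreal" where
  "energy_D d w n a =
     (\<Sum>(i, j) \<in> {(i, j). i < n \<and> j < n \<and> i \<noteq> j}. K d (a ! i - a ! j))
       + ennreal (2 * real (n - 1) / real n) * (\<Sum>i<n. ennreal (Q w (a ! i)))"

definition minimizer_D :: "real \<Rightarrow> (complex \<Rightarrow> complex) \<Rightarrow> nat \<Rightarrow> real list" where
  "minimizer_D d w n = arg_min (energy_D d w n) (\<lambda>a. a \<in> increasing_tuples n)"

definition F_D :: "real \<Rightarrow> (complex \<Rightarrow> complex) \<Rightarrow> nat \<Rightarrow> ennreal" where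
  "F_D d w n =
     energy_D d w n (minimizer_D d w n)
       - ennreal (real (n - 1) / real n) * (\<Sum>i<n. ennreal (Q w (minimizer_D d w n ! i)))"

end

theory Submission
  imports Defs "HOL-Probability.Probability" "HOL-Complex_Analysis.Complex_Analysis"
begin

text \<open>Write m = n - 1, U^P(x) for the potential of a measure P, that is the integral of K(x - y)
  over y, and a_1 < ... < a_n for the points of the discrete minimizer. The continuous minimizer
  is n times a probability measure P, and P minimizes the energy with the field q = Q/n; in these
  terms F_C is n^2 times f, where f is the P-integral of U^P + q. Both existence statements are
  proved by the direct method: sublevel sets of the energy are tight because Q tends to infinity
  (\<open>Q_coercive\<close>, a consequence of Cauchy's formula on rectangles), and the energy is lower
  semicontinuous because K is continuous into [0,\<infinity>] (\<open>field_energy_minimizer_exists\<close>,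
  \<open>minimizer_D_exists\<close>).

  The first inequality compares two potentials. Moving a single point of the discrete minimizer
  to x cannot lower the discrete energy; summed over the points, this says
  F_D \<le> m (K(x - a_1) + ... + K(x - a_n) + Q(x)) for every real x (\<open>F_D_le_potential\<close>). So the
  potential of the uniform distribution on the points, plus q, is everywhere at least
  F_D/(m n). On the other side the variational conditions for P say that U^P + q \<le> f on a
  compact set E carrying P (\<open>frostman_AE_le\<close>). It remains to see that a potential which exceeds
  U^P on E by a constant can do so only by a nonpositive constant (\<open>potential_domination\<close>). One
  integrates against the equilibrium measure of E: its potential is at most a constant
  everywhere, and equal to it P-almost everywhere. The bound everywhere is the maximum principle,
  which on the line comes from convexity of K: a point x in a gap of a closed set S is a convex
  combination of the endpoints of the gap, and K(x - y) is at most the same combination of the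
  values at the endpoints for each y in S.

  The second inequality is a trial measure. Since F_C is at most the minimal continuous energy,
  it is at most the energy of n times any probability measure; the measure chosen picks one of the
  m gaps between consecutive points uniformly, and then a point of that gap uniformly. By convexity
  of Q its field term is controlled by the sum of the Q(a_i). For the interaction terms, K grows by
  at most -ln s when its argument shrinks by the factor s (\<open>K_scaled_le\<close>), so a gap of length h has
  self-energy at most K(h) + 1 + ln 2; two adjacent gaps interact by at most K of their total length
  plus 1; separated gaps interact by at most K of the distance between them. Counting how often each
  pair of points is used (\<open>gap_energy_sum_le\<close>), the sum over all ordered pairs of gaps is at most
  twice the discrete interaction energy plus m (3 + ln 2).
\<close>

section \<open>The logarithmic kernel of the strip\<close>

lemma K_pos_eq:
  assumes "d > 0" "x > 0"
  shows "K d x = ennreal (- ln (tanh (pi / (4 * d) * x)))"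
  using assms by (simp add: K_def)

lemma K_even: "K d (- x) = K d x"
  by (simp add: K_def)

lemma K_abs: "K d \<bar>x\<bar> = K d x"
  by (simp add: abs_if K_even)

lemma K_minus_commute: "K d (x - y) = K d (y - x)"
  using K_even[of d "x - y"] by simp

lemma ln_tanh_nonpos: "0 < x \<Longrightarrow> ln (tanh (x::real)) \<le> 0"
  using tanh_real_lt_1[of x] by (simp add: ln_le_zero_iff)

lemma K_antimono:
  assumes "d > 0" "0 \<le> x" "x \<le> y"
  shows "K d y \<le> K d x"
proof (cases "x = 0")
  case True then show ?thesis by (simp add: K_def)
next
  case False
  let ?c = "pi / (4 * d)"
  have c: "?c > 0" using assms by simp
  have "tanh (?c * x) \<le> tanh (?c * y)" using assms by (simp add: divide_right_mono)
  moreover have "tanh (?c * x) > 0" using assms False by simp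
  ultimately have "ln (tanh (?c * x)) \<le> ln (tanh (?c * y))" using ln_mono by simp
  then show ?thesis using assms False by (simp add: K_pos_eq ennreal_leI)
qed

lemma K_antimono_abs:
  assumes "d > 0" "\<bar>x\<bar> \<le> \<bar>y\<bar>"
  shows "K d y \<le> K d x"
  using K_antimono[OF assms(1) _ assms(2)] by (simp add: K_abs)

lemma K_measurable [measurable]: "K d \<in> borel_measurable borel"
proof -
  have [measurable]: "(\<lambda>x. tanh (pi / (4 * d) * x)) \<in> borel_measurable borel"
    by (intro borel_measurable_continuous_onI continuous_intros) auto
  show ?thesis unfolding K_def[abs_def] by measurable
qed

text \<open>
  Continuity at 0, where the value is infinite, is the essential case: it makes Fatou's lemma
  applicable to measures with atoms and forces infinite energy on points that collide in a limit.
\<close>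

lemma K_continuous_at:
  assumes "d > 0"
  shows "isCont (K d) x"
proof (cases "x = 0")
  case False
  let ?c = "pi / (4 * d)"
  have "isCont (\<lambda>x. ennreal (- ln \<bar>tanh (?c * x)\<bar>)) x"
    using False assms by (intro continuous_intros continuous_at_ennreal) auto
  moreover have "\<forall>\<^sub>F y in nhds x. K d y = ennreal (- ln \<bar>tanh (?c * y)\<bar>)"
    using t1_space_nhds[OF False] by eventually_elim (simp add: K_def)
  ultimately show ?thesis
    by (simp add: isCont_cong)
next
  case True
  let ?c = "pi / (4 * d)"
  have "((\<lambda>x. \<bar>tanh (?c * x)\<bar>) \<longlongrightarrow> \<bar>tanh (?c * 0)\<bar>) (at 0)"
    by (intro tendsto_intros) auto
  moreover have "\<forall>\<^sub>F x in at 0. \<bar>tanh (?c * x)\<bar> \<in> {0<..}"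
    using assms by (auto simp: eventually_at_filter)
  ultimately have "filterlim (\<lambda>x. \<bar>tanh (?c * x)\<bar>) (at_right 0) (at 0)"
    unfolding filterlim_at by (simp add: eventually_conj_iff)
  from filterlim_compose[OF ln_at_0 this]
  have "filterlim (\<lambda>x. - ln \<bar>tanh (?c * x)\<bar>) at_top (at 0)"
    by (simp add: filterlim_uminus_at_top)
  then have "((\<lambda>x. ennreal (- ln \<bar>tanh (?c * x)\<bar>)) \<longlongrightarrow> \<infinity>) (at 0)"
    by (simp add: ennreal_tendsto_top_eq_at_top)
  moreover have "\<forall>\<^sub>F x in at 0. ennreal (- ln \<bar>tanh (?c * x)\<bar>) = K d x"
    by (auto simp: eventually_at_filter K_def)
  ultimately have "(K d \<longlongrightarrow> \<infinity>) (at 0)"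
    by (rule Lim_transform_eventually)
  then show ?thesis using True by (simp add: isCont_def K_def)
qed

lemma K_tendsto:
  assumes "d > 0" "(f \<longlongrightarrow> x) F"
  shows "((\<lambda>n. K d (f n)) \<longlongrightarrow> K d x) F"
  using isCont_tendsto_compose[OF K_continuous_at[OF assms(1)] assms(2)] .

lemma one_minus_tanh_square_over_tanh:
  assumes "u > (0::real)"
  shows "(1 - (tanh u)\<^sup>2) / tanh u = 2 / sinh (2 * u)"
proof -
  have nz: "sinh u \<noteq> 0" "cosh u \<noteq> 0" using assms by (auto simp: cosh_real_nonzero)
  have "1 - (tanh u)\<^sup>2 = ((cosh u)\<^sup>2 - (sinh u)\<^sup>2) / (cosh u)\<^sup>2"
    using nz by (simp add: tanh_def field_simps)
  also have "(cosh u)\<^sup>2 - (sinh u)\<^sup>2 = 1" by (simp add: cosh_square_eq)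
  finally have sq: "1 - (tanh u)\<^sup>2 = 1 / (cosh u)\<^sup>2" .
  show ?thesis unfolding sq sinh_double using nz
    by (simp add: tanh_def power2_eq_square)
qed

text \<open>The derivative is -2c/sinh(2cx), which increases with x.\<close>

lemma convex_on_neg_ln_tanh:
  fixes c :: real
  assumes c: "c > 0"
  shows "convex_on {0<..} (\<lambda>x. - ln (tanh (c * x)))"
proof (rule convex_on_realI)
  show "connected {0::real<..}" by simp
  show "((\<lambda>x. - ln (tanh (c * x))) has_real_derivative - (2 * c / sinh (2 * (c * x)))) (at x)"
    if "x \<in> {0<..}" for x
  proof -
    have pos: "c * x > 0" using that c by (intro mult_pos_pos) auto
    note * = one_minus_tanh_square_over_tanh[OF pos]
    have alg: "1 / T * (U * (c * 1)) = U / T * c" for T U ::  real by simp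
    have nz: "cosh (c * x) \<noteq> 0" by (simp add: cosh_real_nonzero)
    have "((\<lambda>x. tanh (c * x)) has_real_derivative ((1 - (tanh (c * x))\<^sup>2) * (c * 1))) (at x)"
      using nz by (intro has_field_derivative_tanh DERIV_cmult DERIV_ident)
    moreover have "tanh (c * x) > 0" using pos by simp
    ultimately have "((\<lambda>x. - ln (tanh (c * x))) has_real_derivative
        - (1 / tanh (c * x) * ((1 - (tanh (c * x))\<^sup>2) * (c * 1)))) (at x)"
      by (intro DERIV_minus DERIV_chain2[OF DERIV_ln_divide])
    also have "1 / tanh (c * x) * ((1 - (tanh (c * x))\<^sup>2) * (c * 1)) = (1 - (tanh (c * x))\<^sup>2) / tanh (c * x) * c"
      by (rule alg)
    finally show ?thesis unfolding * by (simp add: mult_ac)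
  qed
  show "- (2 * c / sinh (2 * (c * x))) \<le> - (2 * c / sinh (2 * (c * y)))"
    if "x \<in> {0<..}" "y \<in> {0<..}" "x \<le> y" for x y
  proof -
    have "sinh (2 * (c * x)) \<le> sinh (2 * (c * y))" "sinh (2 * (c * x)) > 0"
      using that c by auto
    then show ?thesis using c that by (auto intro!: divide_left_mono mult_pos_pos)
  qed
qed

text \<open>
  Arguments equal to 0 are covered as well: the right-hand side is then infinite, or that argument has weight 0.
\<close>

lemma K_convex:
  assumes d: "d > 0" and "0 \<le> x" "0 \<le> y" "0 \<le> t" "t \<le> 1"
  shows "K d ((1 - t) * x + t * y) \<le> ennreal (1 - t) * K d x + ennreal t * K d y"
proof -
  consider "t = 0" | "t = 1" | "0 < t" "t < 1" "x = 0 \<or> y = 0" | "0 < x" "0 < y"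
    using assms by fastforce
  then show ?thesis
  proof cases
    case 3
    then have "ennreal (1 - t) * K d x + ennreal t * K d y = \<infinity>"
      by (auto simp: K_def ennreal_mult_eq_top_iff)
    then show ?thesis by (metis infinity_ennreal_def top_greatest)
  next
    case 4
    let ?k = "\<lambda>x. - ln (tanh (pi / (4 * d) * x))"
    have pos: "(1 - t) * x + t * y > 0"
      using 4 assms by (cases "t = 0") (auto intro!: add_nonneg_pos)
    have "?k ((1 - t) *\<^sub>R x + t *\<^sub>R y) \<le> (1 - t) * ?k x + t * ?k y"
      using assms 4 by (intro convex_onD[OF convex_on_neg_ln_tanh]) auto
    then have "ennreal (?k ((1 - t) * x + t * y)) \<le> ennreal ((1 - t) * ?k x + t * ?k y)"
      by (intro ennreal_leI) simp
    also have "\<dots> = ennreal (1 - t) * ennreal (?k x) + ennreal t * ennreal (?k y)"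
    proof -
      have "0 \<le> ?k x" "0 \<le> ?k y" using ln_tanh_nonpos 4 d by auto
      then show ?thesis using assms by (simp only: ennreal_plus ennreal_mult mult_nonneg_nonneg diff_ge_0_iff_ge)
    qed
    finally show ?thesis using 4 pos d by (simp only: K_pos_eq)
  qed auto
qed

text \<open>
  The segment from a - y to b - y stays on one side of the pole of K exactly when y is not strictly
  between a and b.
\<close>

lemma K_convex_interval:
  assumes d: "d > 0" and "0 \<le> t" "t \<le> 1" "y \<le> a \<and> y \<le> b \<or> a \<le> y \<and> b \<le> y"
  shows "K d (((1 - t) * a + t * b) - y) \<le> ennreal (1 - t) * K d (a - y) + ennreal t * K d (b - y)"
  using assms(4)
proof
  assume "y \<le> a \<and> y \<le> b"
  then show ?thesis
    using K_convex[OF d, of "a - y" "b - y" t] assms by (simp add: algebra_simps)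
next
  assume *: "a \<le> y \<and> b \<le> y"
  have "y - ((1 - t) * a + t * b) = (1 - t) * (y - a) + t * (y - b)" by (simp add: algebra_simps)
  then show ?thesis
    using K_convex[OF d, of "y - a" "y - b" t] * assms
    by (simp add: K_minus_commute[of d _ y])
qed

text \<open>Concavity of tanh on [0,\<infinity>), compared at 0 and h.\<close>

lemma tanh_scaled_ge:
  assumes "0 \<le> s" "s \<le> 1" "0 \<le> (h::real)"
  shows "s * tanh h \<le> tanh (s * h)"
proof -
  have "convex_on {0..} (\<lambda>x::real. - tanh x)"
  proof (rule convex_on_realI)
    show "((\<lambda>x::real. - tanh x) has_real_derivative - (1 - (tanh x)\<^sup>2)) (at x)" for x
      by (auto intro!: derivative_eq_intros simp: cosh_real_nonzero)
  qed (auto intro!: power_mono)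
  from convex_onD[OF this, of s 0 h] show ?thesis using assms by simp
qed

text \<open>
  K grows no faster than the logarithm when its argument shrinks; the constants 1 and 1 + ln 2 in the bounds below come from this.
\<close>

lemma K_scaled_le:
  assumes "d > 0" "0 < s" "s \<le> 1" "0 < h"
  shows "K d (s * h) \<le> K d h + ennreal (- ln s)"
proof -
  let ?c = "pi / (4 * d)"
  have c: "?c * h > 0" using assms by simp
  then have t: "tanh (?c * h) > 0" by simp
  have "s * tanh (?c * h) \<le> tanh (s * (?c * h))"
    using assms c by (intro tanh_scaled_ge) auto
  then have "ln (s * tanh (?c * h)) \<le> ln (tanh (s * (?c * h)))"
    using assms t by (intro ln_mono) auto
  moreover have "ln (s * tanh (?c * h)) = ln s + ln (tanh (?c * h))"
    using assms t by (intro ln_mult_pos) auto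
  ultimately have "- ln (tanh (?c * (s * h))) \<le> - ln (tanh (?c * h)) + - ln s"
    by (simp add: mult_ac)
  then have "ennreal (- ln (tanh (?c * (s * h)))) \<le> ennreal (- ln (tanh (?c * h)) + - ln s)"
    by (rule ennreal_leI)
  also have "\<dots> = ennreal (- ln (tanh (?c * h))) + ennreal (- ln s)"
    using assms ln_tanh_nonpos[OF c] by (intro ennreal_plus) auto
  finally show ?thesis using assms by (simp add: K_pos_eq)
qed

text \<open>
  Every interval is parametrized by (0,1), so that averages over different intervals are integrals
  with respect to one and the same probability measure.
\<close>

abbreviation U01 :: "real measure" where "U01 \<equiv> uniform_measure lborel {0<..<1}"

lemma prob_space_U01: "prob_space U01"
  by (intro prob_space_uniform_measure) auto

lemma AE_U01: "AE s in U01. 0 < s \<and> s < 1"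
  by (rule AE_uniform_measureI) auto

lemma nn_integral_U01:
  "f \<in> borel_measurable borel \<Longrightarrow>
    (\<integral>\<^sup>+s. f s \<partial>U01) = (\<integral>\<^sup>+s. f s * indicator {0<..<1} s \<partial>lborel)"
  by (subst nn_integral_uniform_measure) (auto simp: divide_ennreal_def)

lemma nn_integral_neg_ln: "(\<integral>\<^sup>+s. ennreal (- ln s) \<partial>U01) = 1"
proof -
  have lim: "((\<lambda>x::real. x - x * ln x) \<longlongrightarrow> 0) (at_right 0)" by real_asymp
  have "((\<lambda>x::real. - ln x) has_integral ((1 - 1 * ln 1) - (0 - 0 * ln 0))) {0..1}"
  proof (rule fundamental_theorem_of_calculus_interior)
    show "continuous_on {0..1} (\<lambda>x::real. x - x * ln x)"
    proof (rule continuous_on_IccI)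
      show "(\<lambda>x::real. x - x * ln x) \<midarrow>x\<rightarrow> x - x * ln x" if "0 < x" "x < 1" for x
        using that by (intro tendsto_intros) auto
      show "((\<lambda>x::real. x - x * ln x) \<longlongrightarrow> 1 - 1 * ln 1) (at_left 1)"
        by (intro tendsto_intros) auto
    qed (use lim in auto)
    show "((\<lambda>x. x - x * ln x) has_vector_derivative - ln x) (at x)" if "x \<in> {0<..<1}" for x :: real
      using that unfolding has_real_derivative_iff_has_vector_derivative[symmetric]
      by (auto intro!: derivative_eq_intros)
  qed auto
  then have "((\<lambda>x::real. - ln x) has_integral 1) {0<..<1}"
    by (simp add: has_integral_Icc_iff_Ioo)
  from nn_integral_has_integral_lebesgue[OF _ this]
  have "(\<integral>\<^sup>+x. ennreal (indicator {0<..<1} x * - ln x) \<partial>lborel) = 1" by simp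
  moreover have "ennreal (indicator {0<..<1} x * - ln x) = ennreal (- ln x) * indicator {0<..<1} x" for x::real
    by (auto simp: indicator_def)
  ultimately show ?thesis by (simp add: nn_integral_U01)
qed

text \<open>The constant is the integral of -ln s over (0,1).\<close>

lemma K_average_le:
  assumes "d > 0" "0 < h"
  shows "(\<integral>\<^sup>+s. K d (s * h) \<partial>U01) \<le> K d h + 1"
proof -
  have "(\<integral>\<^sup>+s. K d (s * h) \<partial>U01) \<le> (\<integral>\<^sup>+s. K d h + ennreal (- ln s) \<partial>U01)"
    using AE_U01 by (intro nn_integral_mono_AE, eventually_elim) (auto intro!: K_scaled_le assms)
  also have "\<dots> = (\<integral>\<^sup>+s. K d h \<partial>U01) + (\<integral>\<^sup>+s. ennreal (- ln s) \<partial>U01)"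
    by (rule nn_integral_add) auto
  also have "\<dots> = K d h + 1"
    using prob_space.emeasure_space_1[OF prob_space_U01] by (simp add: nn_integral_neg_ln)
  finally show ?thesis .
qed

section \<open>Energies of measures and existence of minimizers\<close>

definition potential :: "real \<Rightarrow> real measure \<Rightarrow> real \<Rightarrow> ennreal" where
  "potential d P x = (\<integral>\<^sup>+y. K d (x - y) \<partial>P)"

definition mutual_energy :: "real \<Rightarrow> real measure \<Rightarrow> real measure \<Rightarrow> ennreal" where
  "mutual_energy d P R = (\<integral>\<^sup>+x. potential d R x \<partial>P)"

text \<open>
  If \<mu> = n P and q = Q/n, the continuous energy of \<mu> is n^2 times this quantity. The field is allowed
  the value \<infinity>, so that measures confined to a set E are covered by the field that is 0 on E and
  \<infinity> elsewhere.
\<close>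

definition field_energy :: "real \<Rightarrow> (real \<Rightarrow> ennreal) \<Rightarrow> real measure \<Rightarrow> ennreal" where
  "field_energy d q P = mutual_energy d P P + 2 * (\<integral>\<^sup>+x. q x \<partial>P)"

text \<open>
  The sequential form of lower semicontinuity is the one that Fatou's lemma produces and consumes.
\<close>

definition seq_lsc :: "(real \<Rightarrow> ennreal) \<Rightarrow> bool" where
  "seq_lsc q \<longleftrightarrow> (\<forall>X x. X \<longlonglongrightarrow> x \<longrightarrow> q x \<le> liminf (\<lambda>n. q (X n)))"

lemma seq_lscD: "seq_lsc q \<Longrightarrow> X \<longlonglongrightarrow> x \<Longrightarrow> q x \<le> liminf (\<lambda>n. q (X n))"
  by (simp add: seq_lsc_def)

lemma real_distributionI: "prob_space P \<Longrightarrow> sets P = sets borel \<Longrightarrow> real_distribution P"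
  by (simp add: real_distribution_def real_distribution_axioms_def)

lemma real_distributionD:
  assumes "real_distribution P"
  shows "prob_space P" "sets P = sets borel" "space P = UNIV" "emeasure P UNIV = 1"
proof -
  interpret real_distribution P by fact
  show "prob_space P" "sets P = sets borel" "space P = UNIV"  by unfold_locales simp_all
  show "emeasure P UNIV = 1" using emeasure_space_1 by simp
qed

lemma potential_measurable [measurable]:
  assumes "real_distribution P"
  shows "potential d P \<in> borel_measurable borel"
proof -
  interpret real_distribution P by fact
  show ?thesis unfolding potential_def[abs_def] by measurable
qed

lemma mutual_energy_commute:
  assumes "real_distribution P" "real_distribution R"
  shows "mutual_energy d P R = mutual_energy d R P"
proof -
  interpret P: real_distribution P by fact
  interpret R: real_distribution R by fact
  interpret pair_sigma_finite R P by standard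
  show ?thesis unfolding mutual_energy_def potential_def
    by (subst Fubini') (simp_all add: K_minus_commute)
qed

lemma le_liminf_if_tendsto:
  fixes f :: "nat \<Rightarrow> ennreal"
  shows "f \<longlonglongrightarrow> l \<Longrightarrow> l \<le> liminf f"
  by (simp add: lim_imp_Liminf)

lemma liminf_add_le_ennreal:
  fixes f g :: "nat \<Rightarrow> ennreal"
  shows "liminf f + liminf g \<le> liminf (\<lambda>n. f n + g n)"
proof -
  have "liminf f + liminf g = (SUP n. (INF m\<in>{n..}. f m) + (INF m\<in>{n..}. g m))"
    unfolding liminf_SUP_INF
    by (rule ennreal_SUP_add[symmetric]) (auto intro!: incseq_SucI INF_superset_mono)
  also have "\<dots> \<le> (SUP n. (INF m\<in>{n..}. f m + g m))"
    by (intro SUP_mono') (auto intro!: INF_greatest add_mono INF_lower)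
  finally show ?thesis unfolding liminf_SUP_INF .
qed

text \<open>Fatou's lemma, because K is continuous with values in [0,\<infinity>].\<close>

lemma potential_seq_lsc:
  assumes d: "d > 0" and P: "real_distribution P"
  shows "seq_lsc (potential d P)"
  unfolding seq_lsc_def
proof safe
  interpret real_distribution P by fact
  fix X :: "nat \<Rightarrow> real" and x assume X: "X \<longlonglongrightarrow> x"
  have "potential d P x \<le> (\<integral>\<^sup>+y. liminf (\<lambda>n. K d (X n - y)) \<partial>P)"
    unfolding potential_def
    by (intro nn_integral_mono le_liminf_if_tendsto K_tendsto d tendsto_intros X)
  also have "\<dots> \<le> liminf (\<lambda>n. potential d P (X n))"
    unfolding potential_def by (rule nn_integral_liminf) measurable
  finally show "potential d P x \<le> liminf (\<lambda>n. potential d P (X n))" .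
qed

lemma seq_lsc_add:
  assumes "seq_lsc f" "seq_lsc g"
  shows "seq_lsc (\<lambda>x. f x + g x)"
  unfolding seq_lsc_def
proof (intro allI impI)
  fix X x assume "X \<longlonglongrightarrow> (x::real)"
  then have "f x \<le> liminf (\<lambda>n. f (X n))" "g x \<le> liminf (\<lambda>n. g (X n))"
    using assms unfolding seq_lsc_def by blast+
  then show "f x + g x \<le> liminf (\<lambda>n. f (X n) + g (X n))"
    by (rule order_trans[OF add_mono liminf_add_le_ennreal])
qed

lemma closed_sublevel_seq_lsc:
  assumes "seq_lsc f"
  shows "closed {x. f x \<le> c}"
  unfolding closed_sequential_limits
proof safe
  fix X x assume X: "\<forall>n. X n \<in> {x. f x \<le> c}" "X \<longlonglongrightarrow> x"
  have "f x \<le> liminf (\<lambda>n. f (X n))" using assms X by (simp add: seq_lsc_def)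
  also have "\<dots> \<le> liminf (\<lambda>n::nat. c)" using X by (intro Liminf_mono) auto
  finally show "f x \<le> c" by (simp add: Liminf_const)
qed

lemma seq_lsc_measurable:
  assumes "seq_lsc f"
  shows "f \<in> borel_measurable borel"
  by (rule borel_measurableI_le) (use closed_sublevel_seq_lsc[OF assms] in auto)

lemma field_energy_distr:
  assumes "prob_space \<Omega>" and [measurable]: "Y \<in> borel_measurable \<Omega>" "q \<in> borel_measurable borel"
  shows "field_energy d q (distr \<Omega> borel Y) =
     (\<integral>\<^sup>+s. \<integral>\<^sup>+t. K d (Y s - Y t) \<partial>\<Omega> \<partial>\<Omega>) + 2 * (\<integral>\<^sup>+s. q (Y s) \<partial>\<Omega>)"
proof -
  interpret prob_space \<Omega> by fact
  have "real_distribution (distr \<Omega> borel Y)"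
    by (intro real_distributionI prob_space_distr) auto
  note [measurable] = potential_measurable[OF this]
  show ?thesis unfolding field_energy_def mutual_energy_def
    by (simp add: nn_integral_distr potential_def)
qed

text \<open>
  Skorohod's representation realizes the weakly convergent measures as distributions of random
  variables that converge pointwise on one probability space. The energies become double integrals
  over that space, to which Fatou's lemma applies once for each variable.
\<close>

lemma field_energy_weak_lsc:
  assumes d: "d > 0" and q: "seq_lsc q"
    and R: "\<And>k. real_distribution (R k)" and P: "real_distribution P" and conv: "weak_conv_m R P"
  shows "field_energy d q P \<le> liminf (\<lambda>k. field_energy d q (R k))"
proof -
  note [measurable] = seq_lsc_measurable[OF q]
  obtain \<Omega> :: "real measure" and Z :: "nat \<Rightarrow> real \<Rightarrow> real" and Y :: "real \<Rightarrow> real" where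
    \<Omega>: "prob_space \<Omega>" and Z[measurable]: "\<And>n. Z n \<in> borel_measurable \<Omega>" and dZ: "\<And>n. distr \<Omega> borel (Z n) = R n"
    and Y: "Y \<in> measurable \<Omega> lborel" and dY: "distr \<Omega> borel Y = P"
    and lim: "\<And>x. x \<in> space \<Omega> \<Longrightarrow> (\<lambda>n. Z n x) \<longlonglongrightarrow> Y x"
    using Skorohod[OF R P conv] by blast
  have Y[measurable]: "Y \<in> borel_measurable \<Omega>" using Y by simp
  interpret prob_space \<Omega> by fact
  have "(\<integral>\<^sup>+s. \<integral>\<^sup>+t. K d (Y s - Y t) \<partial>\<Omega> \<partial>\<Omega>) \<le> (\<integral>\<^sup>+s. liminf (\<lambda>n. \<integral>\<^sup>+t. K d (Z n s - Z n t) \<partial>\<Omega>) \<partial>\<Omega>)"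
  proof (rule nn_integral_mono)
    fix s assume s: "s \<in> space \<Omega>"
    have "(\<integral>\<^sup>+t. K d (Y s - Y t) \<partial>\<Omega>) \<le> (\<integral>\<^sup>+t. liminf (\<lambda>n. K d (Z n s - Z n t)) \<partial>\<Omega>)"
      by (intro nn_integral_mono le_liminf_if_tendsto K_tendsto d tendsto_intros lim s)
    also have "\<dots> \<le> liminf (\<lambda>n. \<integral>\<^sup>+t. K d (Z n s - Z n t) \<partial>\<Omega>)"
      by (rule nn_integral_liminf) measurable
    finally show "(\<integral>\<^sup>+t. K d (Y s - Y t) \<partial>\<Omega>) \<le> \<dots>" .
  qed
  also have "\<dots> \<le> liminf (\<lambda>n. \<integral>\<^sup>+s. \<integral>\<^sup>+t. K d (Z n s - Z n t) \<partial>\<Omega> \<partial>\<Omega>)"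
    by (rule nn_integral_liminf) measurable
  finally have 1: "(\<integral>\<^sup>+s. \<integral>\<^sup>+t. K d (Y s - Y t) \<partial>\<Omega> \<partial>\<Omega>) \<le> liminf (\<lambda>n. \<integral>\<^sup>+s. \<integral>\<^sup>+t. K d (Z n s - Z n t) \<partial>\<Omega> \<partial>\<Omega>)" .
  have "2 * (\<integral>\<^sup>+s. q (Y s) \<partial>\<Omega>) = (\<integral>\<^sup>+s. 2 * q (Y s) \<partial>\<Omega>)" by (simp add: nn_integral_cmult)
  also have "\<dots> \<le> (\<integral>\<^sup>+s. liminf (\<lambda>n. 2 * q (Z n s)) \<partial>\<Omega>)"
  proof (rule nn_integral_mono)
    fix s assume s: "s \<in> space \<Omega>"
    have *: "q (Y s) \<le> liminf (\<lambda>n. q (Z n s))" by (rule seq_lscD[OF q lim[OF s]])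
    have "q (Y s) + q (Y s) \<le> liminf (\<lambda>n. q (Z n s) + q (Z n s))"
      by (rule order_trans[OF add_mono[OF * *] liminf_add_le_ennreal])
    then show "2 * q (Y s) \<le> liminf (\<lambda>n. 2 * q (Z n s))" by (simp only: mult_2)
  qed
  also have "\<dots> \<le> liminf (\<lambda>n. \<integral>\<^sup>+s. 2 * q (Z n s) \<partial>\<Omega>)"
    by (rule nn_integral_liminf) measurable
  also have "\<dots> = liminf (\<lambda>n. 2 * (\<integral>\<^sup>+s. q (Z n s) \<partial>\<Omega>))"
    by (simp add: nn_integral_cmult)
  finally have 2: "2 * (\<integral>\<^sup>+s. q (Y s) \<partial>\<Omega>) \<le> \<dots>" .
  have "field_energy d q P \<le> liminf (\<lambda>k. field_energy d q (distr \<Omega> borel (Z k)))"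
    unfolding dY[symmetric] field_energy_distr[OF \<Omega> Y seq_lsc_measurable[OF q]] field_energy_distr[OF \<Omega> Z seq_lsc_measurable[OF q]]
    by (rule order_trans[OF add_mono[OF 1 2] liminf_add_le_ennreal])
  then show ?thesis by (simp add: dZ)
qed

text \<open>Markov's inequality for the field.\<close>

lemma tight_if_field_energy_bounded:
  assumes q: "q \<in> borel_measurable borel"
    and coercive: "\<And>C::real. \<exists>R. \<forall>x. q x \<le> ennreal C \<longrightarrow> \<bar>x\<bar> \<le> R"
    and R: "\<And>k. real_distribution (R k)"
    and bound: "\<And>k. field_energy d q (R k) \<le> ennreal M"
  shows "tight R"
  unfolding tight_def
proof (intro conjI allI impI R)
  fix \<epsilon> :: real assume \<epsilon>: "\<epsilon> > 0"
  note [measurable] = q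
  \<comment> \<open>the level of q at which the bound from Markov's inequality drops below \<epsilon>\<close>
  define C where "C = (\<bar>M\<bar> + 1) / \<epsilon>"
  have C: "C > 0" using \<epsilon> by (simp add: C_def add_nonneg_pos)
  obtain r where r: "\<And>x. q x \<le> ennreal C \<Longrightarrow> \<bar>x\<bar> \<le> r" using coercive[of C] by blast
  define b where "b = \<bar>r\<bar> + 1"
  have "measure (R k) {-b<..b} > 1 - \<epsilon>" for k
  proof -
    interpret real_distribution "R k" by (rule R)
    have "emeasure (R k) (- {-b<..b}) \<le> emeasure (R k) ({x\<in>UNIV. 1 \<le> ennreal (1 / C) * q x})"
    proof (rule emeasure_mono)
      show "- {-b<..b} \<subseteq> {x\<in>UNIV. 1 \<le> ennreal (1 / C) * q x}"
      proof
        fix x assume "x \<in> - {-b<..b}"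
        then have "\<not> \<bar>x\<bar> \<le> r" by (auto simp: b_def)
        then have "\<not> q x \<le> ennreal C" using r by blast
          then have "ennreal C \<le> q x" by (simp only: not_le less_imp_le)
        then have "ennreal (1 / C) * ennreal C \<le> ennreal (1 / C) * q x" by (rule mult_left_mono) simp
        then show "x \<in> {x\<in>UNIV. 1 \<le> ennreal (1 / C) * q x}"
          using C by (simp add: ennreal_mult[symmetric])
      qed
    qed measurable
    also have "\<dots> \<le> ennreal (1 / C) * (\<integral>\<^sup>+x. q x * indicator UNIV x \<partial>R k)"
      by (rule nn_integral_Markov_inequality[where u=q and A=UNIV]) auto
    also have "\<dots> \<le> ennreal (1 / C) * ennreal \<bar>M\<bar>"
    proof (rule mult_left_mono)
      have "(\<integral>\<^sup>+x. q x \<partial>R k) \<le> 2 * (\<integral>\<^sup>+x. q x \<partial>R k)" by (simp add: mult_2)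
      also have "\<dots> \<le> ennreal M" using bound[of k] unfolding field_energy_def by (rule order_trans[rotated]) simp
      also have "\<dots> \<le> ennreal \<bar>M\<bar>" by (intro ennreal_leI) simp
      finally show "(\<integral>\<^sup>+x. q x * indicator UNIV x \<partial>R k) \<le> ennreal \<bar>M\<bar>" by simp
    qed simp
    also have "\<dots> = ennreal (\<bar>M\<bar> / C)" using C by (simp add: ennreal_mult[symmetric])
    finally have "measure (R k) (- {-b<..b}) \<le> \<bar>M\<bar> / C"
      using C by (simp add: emeasure_eq_measure)
    also have "\<dots> < \<epsilon>" using \<epsilon> C by (simp add: C_def field_simps)
    finally show ?thesis using prob_compl[of "{-b<..b}"] by (simp add: Compl_eq_Diff_UNIV)
  qed
  moreover have "-b < b" by (simp add: b_def)
  ultimately show "\<exists>a b. a < b \<and> (\<forall>n. 1 - \<epsilon> < measure (R n) {a<..b})" by blast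
qed

text \<open>
  The direct method: a minimizing sequence is tight, a weak limit of a subsequence exists, and lower
  semicontinuity makes it a minimizer.
\<close>

lemma field_energy_minimizer_exists:
  assumes d: "d > 0" and q: "seq_lsc q"
    and coercive: "\<And>C::real. \<exists>R. \<forall>x. q x \<le> ennreal C \<longrightarrow> \<bar>x\<bar> \<le> R"
    and R0: "real_distribution R0" "field_energy d q R0 < \<infinity>"
  shows "\<exists>P. real_distribution P \<and> field_energy d q P < \<infinity> \<and>
           (\<forall>R. real_distribution R \<longrightarrow> field_energy d q P \<le> field_energy d q R)"
proof -
  define A where "A = field_energy d q ` Collect real_distribution"
  define m where "m = Inf A"
  have "m \<le> field_energy d q R0" unfolding m_def A_def using R0 by (intro Inf_lower) auto
  then have m: "m < \<infinity>" using R0 by simp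
  have "A \<noteq> {}" using R0 by (auto simp: A_def)
  then obtain f where f: "decseq f" "range f \<subseteq> A" "m = (INF i. f i)"
    unfolding m_def using ennreal_Inf_countable_INF by blast
  have "f \<longlonglongrightarrow> m" unfolding f(3) by (rule LIMSEQ_INF) (rule f)
  have "\<exists>i. f i < \<infinity>" using m unfolding f(3) by (auto simp: INF_less_iff)
  then obtain i where i: "f i < \<infinity>" by blast
  define R where "R k = (SOME R. real_distribution R \<and> field_energy d q R = f (i + k))" for k
  have R: "real_distribution (R k) \<and> field_energy d q (R k) = f (i + k)" for k
  proof -
    have "f (i + k) \<in> A" using f(2) by blast
    then have "\<exists>R. real_distribution R \<and> field_energy d q R = f (i + k)" by (auto simp: A_def)
    then show ?thesis unfolding R_def by (rule someI_ex)
  qed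
  obtain M where M: "M \<ge> 0" "f i = ennreal M" using i by (cases "f i") auto
  have "tight R"
  proof (rule tight_if_field_energy_bounded[OF seq_lsc_measurable[OF q] coercive])
    show "field_energy d q (R k) \<le> ennreal M" for k
      using R[of k] f(1) M by (metis decseqD le_add1)
  qed (use R in auto)
  from tight_imp_convergent_subsubsequence[OF this strict_mono_id]
  obtain r P where r: "strict_mono (r :: nat \<Rightarrow> nat)" and P: "real_distribution P" "weak_conv_m (R \<circ> id \<circ> r) P" by blast
  have "field_energy d q P \<le> liminf (\<lambda>k. field_energy d q ((R \<circ> id \<circ> r) k))"
    by (rule field_energy_weak_lsc[OF d q _ P]) (use R in auto)
  also have "(\<lambda>k. field_energy d q ((R \<circ> id \<circ> r) k)) = (\<lambda>k. f (i + r k))" using R by auto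
  also have "liminf \<dots> = m"
  proof (rule lim_imp_Liminf)
    have "filterlim (\<lambda>k. i + r k) sequentially sequentially"
      by (rule filterlim_subseq) (use r in \<open>simp add: strict_mono_def\<close>)
    then show "(\<lambda>k. f (i + r k)) \<longlonglongrightarrow> m" using \<open>f \<longlonglongrightarrow> m\<close> by (rule filterlim_compose[rotated])
  qed simp
  finally have le: "field_energy d q P \<le> m" .
  show ?thesis
  proof (intro exI[of _ P] conjI allI impI P(1))
    show "field_energy d q P < \<infinity>" using le m by simp
    fix R assume "real_distribution R"
    then have "m \<le> field_energy d q R" unfolding m_def A_def by (intro Inf_lower) auto
    then show "field_energy d q P \<le> field_energy d q R" using le by simp
  qed
qed

section \<open>Frostman conditions, maximum principle and domination\<close>

text \<open>
  The mixture is drawn in two steps: a coin with bias t decides whether to draw from R or from P.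
\<close>

lemma mixture_exists:
  assumes P: "real_distribution P" and R: "real_distribution R" and t: "0 \<le> t" "t \<le> 1"
  shows "\<exists>M. real_distribution M \<and> (\<forall>f. f \<in> borel_measurable borel \<longrightarrow>
    (\<integral>\<^sup>+x. f x \<partial>M) = ennreal (1 - t) * (\<integral>\<^sup>+x. f x \<partial>P) + ennreal t * (\<integral>\<^sup>+x. f x \<partial>R))"
proof -
  note P' = real_distributionD[OF P] and R' = real_distributionD[OF R]
  let ?N = "\<lambda>b. if b then R else P"
  have N: "?N \<in> measurable (measure_pmf (bernoulli_pmf t)) (subprob_algebra borel)"
    using P' R' by (auto simp: space_subprob_algebra prob_space_imp_subprob_space)
  have int: "(\<integral>\<^sup>+x. f x \<partial>(measure_pmf (bernoulli_pmf t) \<bind> ?N)) =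
      ennreal (1 - t) * (\<integral>\<^sup>+x. f x \<partial>P) + ennreal t * (\<integral>\<^sup>+x. f x \<partial>R)"
    if "f \<in> borel_measurable borel" for f
    using t by (simp add: nn_integral_bind[OF that N] mult.commute add.commute)
  have sets: "sets (measure_pmf (bernoulli_pmf t) \<bind> ?N) = sets borel"
    by (rule sets_bind[OF sets_kernel[OF N]]) auto
  have "prob_space (measure_pmf (bernoulli_pmf t) \<bind> ?N)"
  proof (rule prob_spaceI)
    have "emeasure (measure_pmf (bernoulli_pmf t) \<bind> ?N) (space (measure_pmf (bernoulli_pmf t) \<bind> ?N))
       = (\<integral>\<^sup>+x. 1 \<partial>(measure_pmf (bernoulli_pmf t) \<bind> ?N))" by simp
    also have "\<dots> = ennreal (1 - t) + ennreal t"
      using P' R' by (subst int) simp_all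
    also have "\<dots> = 1" using t by (subst ennreal_plus[symmetric]) auto
    finally show "emeasure (measure_pmf (bernoulli_pmf t) \<bind> ?N) (space (measure_pmf (bernoulli_pmf t) \<bind> ?N)) = 1" .
  qed
  with sets int show ?thesis by (blast intro: real_distributionI)
qed

text \<open>
  The right-hand side minus the left-hand side is t times an affine function of t, whose value at
  t = 0 is 2 (b + r) - 2 (a + p).
\<close>

lemma quadratic_derivative_nonneg:
  fixes a b c p r :: real
  assumes "\<And>t. 0 < t \<Longrightarrow> t < 1 \<Longrightarrow>
    a + 2 * p \<le> (1 - t)\<^sup>2 * a + 2 * t * (1 - t) * b + t\<^sup>2 * c + 2 * (1 - t) * p + 2 * t * r"
  shows "a + p \<le> b + r"
proof (rule field_le_epsilon)
  fix e :: real assume e: "e > 0"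
  \<comment> \<open>small enough for the second-order term to be at most e\<close>
  define t where "t = min (1/2) (e / (\<bar>a - 2 * b + c\<bar> + 1))"
  have t: "0 < t" "t < 1" using e by (auto simp: t_def)
  have "t * (\<bar>a - 2 * b + c\<bar> + 1) \<le> e"
  proof -
    have "t \<le> e / (\<bar>a - 2 * b + c\<bar> + 1)" by (simp add: t_def)
    then show ?thesis by (subst (asm) pos_le_divide_eq) auto
  qed
  moreover have "t * (a - 2 * b + c) \<le> t * (\<bar>a - 2 * b + c\<bar> + 1)" using t by (intro mult_left_mono) auto
  ultimately have le: "t * (a - 2 * b + c) \<le> e" by linarith
  have "0 \<le> t * (2 * (b + r) - 2 * (a + p) + t * (a - 2 * b + c))"
    using assms[OF t] by (simp add: power2_eq_square algebra_simps)
  then have "0 \<le> 2 * (b + r) - 2 * (a + p) + t * (a - 2 * b + c)"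
    using t by (simp add: zero_le_mult_iff)
  with le have "0 \<le> 2 * (b + r) - 2 * (a + p) + e" by (rule order_trans[OF _ add_left_mono, rotated])
  then show "a + p \<le> b + r + e" using e by simp
qed

lemma ennreal_lin_comb:
  assumes "0 \<le> u" "0 \<le> v" "0 \<le> x" "0 \<le> y"
  shows "ennreal u * ennreal x + ennreal v * ennreal y = ennreal (u * x + v * y)"
  using assms by (simp add: ennreal_mult ennreal_plus)

text \<open>
  The first-order condition for a minimizer in the direction R - P: along the mixtures of P and R the
  energy is a quadratic polynomial in the mixing parameter, minimal at 0.
\<close>

lemma frostman_integrated:
  assumes P: "real_distribution P" and q[measurable]: "q \<in> borel_measurable borel"
    and fin: "field_energy d q P < \<infinity>"
    and min: "\<And>R. real_distribution R \<Longrightarrow> field_energy d q P \<le> field_energy d q R"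
    and R: "real_distribution R" "mutual_energy d R R < \<infinity>" "(\<integral>\<^sup>+x. q x \<partial>R) < \<infinity>"
  shows "mutual_energy d P P + (\<integral>\<^sup>+x. q x \<partial>P) \<le> (\<integral>\<^sup>+x. potential d P x + q x \<partial>R)"
proof -
  note [measurable] = potential_measurable[OF P] potential_measurable[OF R(1)]
  interpret P: real_distribution P by fact
  interpret R: real_distribution R by fact
  have eq: "(\<integral>\<^sup>+x. potential d P x + q x \<partial>R) = mutual_energy d R P + (\<integral>\<^sup>+x. q x \<partial>R)"
    unfolding mutual_energy_def by (rule nn_integral_add) measurable
  show ?thesis
  proof (cases "mutual_energy d R P = \<infinity>")
    case True
    then show ?thesis unfolding eq by simp
  next
    case False
    have "mutual_energy d P P < \<infinity>" "(\<integral>\<^sup>+x. q x \<partial>P) < \<infinity>"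
      using fin by (auto simp: field_energy_def ennreal_mult_less_top)
    then obtain a p where a: "a \<ge> 0" "mutual_energy d P P = ennreal a"
      and p: "p \<ge> 0" "(\<integral>\<^sup>+x. q x \<partial>P) = ennreal p"
      by (auto simp: less_top_ennreal ennreal_mult_less_top)
    obtain c r where c: "c \<ge> 0" "mutual_energy d R R = ennreal c"
      and r: "r \<ge> 0" "(\<integral>\<^sup>+x. q x \<partial>R) = ennreal r" using R(2,3) by (auto simp: less_top_ennreal)
    obtain b where b: "b \<ge> 0" "mutual_energy d R P = ennreal b"
      using False by (cases "mutual_energy d R P") auto
    have b': "mutual_energy d P R = ennreal b" using b mutual_energy_commute[OF P R(1)] by simp
    have "a + p \<le> b + r"
    proof (rule quadratic_derivative_nonneg)
      fix t :: real assume t: "0 < t" "t < 1"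
      then obtain M where M: "real_distribution M" and int: "\<And>f. f \<in> borel_measurable borel \<Longrightarrow>
        (\<integral>\<^sup>+x. f x \<partial>M) = ennreal (1 - t) * (\<integral>\<^sup>+x. f x \<partial>P) + ennreal t * (\<integral>\<^sup>+x. f x \<partial>R)"
        using mixture_exists[OF P R(1), of t] by auto
      note [measurable] = potential_measurable[OF M]
      have pot: "potential d M x = ennreal (1 - t) * potential d P x + ennreal t * potential d R x" for x
        unfolding potential_def by (rule int) measurable
      have "mutual_energy d M M = ennreal (1 - t) * (\<integral>\<^sup>+x. potential d M x \<partial>P) + ennreal t * (\<integral>\<^sup>+x. potential d M x \<partial>R)"
        unfolding mutual_energy_def by (rule int) measurable
      also have "\<dots> = ennreal (1 - t) * (ennreal (1 - t) * mutual_energy d P P + ennreal t * mutual_energy d P R)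
          + ennreal t * (ennreal (1 - t) * mutual_energy d R P + ennreal t * mutual_energy d R R)"
        unfolding pot mutual_energy_def by (simp add: nn_integral_add nn_integral_cmult)
      also have "\<dots> = ennreal ((1 - t) * ((1 - t) * a + t * b) + t * ((1 - t) * b + t * c))"
      proof -
        have "0 \<le> (1 - t) * a + t * b" "0 \<le> (1 - t) * b + t * c" using t a b c by simp_all
        then show ?thesis using t a(1) b(1) c(1) unfolding a(2) b(2) b' c(2)
          by (simp only: ennreal_lin_comb less_imp_le diff_ge_0_iff_ge)
      qed
      finally have mu: "mutual_energy d M M = \<dots>" .
      have mq: "2 * (\<integral>\<^sup>+x. q x \<partial>M) = ennreal (2 * ((1 - t) * p + t * r))"
      proof -
        have "0 \<le> (1 - t) * p + t * r" using t p r by simp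
        moreover have "(\<integral>\<^sup>+x. q x \<partial>M) = ennreal ((1 - t) * p + t * r)"
          using t p(1) r(1) unfolding int[OF q] p(2) r(2)
          by (simp only: ennreal_lin_comb less_imp_le diff_ge_0_iff_ge)
        ultimately show ?thesis by (simp only: ennreal_mult ennreal_numeral zero_le_numeral)
      qed
      have "field_energy d q M = ennreal (((1 - t) * ((1 - t) * a + t * b) + t * ((1 - t) * b + t * c)) + 2 * ((1 - t) * p + t * r))"
      proof -
        have "0 \<le> (1 - t) * ((1 - t) * a + t * b) + t * ((1 - t) * b + t * c)" "0 \<le> 2 * ((1 - t) * p + t * r)"
          using t a b c p r by simp_all
        then show ?thesis unfolding field_energy_def mu mq by (simp only: ennreal_plus)
      qed
      moreover have "field_energy d q P = ennreal (a + 2 * p)"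
        unfolding field_energy_def a(2) p(2) using a p by (simp add: ennreal_mult ennreal_plus)
      ultimately have "ennreal (a + 2 * p) \<le> ennreal (((1 - t) * ((1 - t) * a + t * b) + t * ((1 - t) * b + t * c)) + 2 * ((1 - t) * p + t * r))"
        using min[OF M] by simp
      then have "a + 2 * p \<le> ((1 - t) * ((1 - t) * a + t * b) + t * ((1 - t) * b + t * c)) + 2 * ((1 - t) * p + t * r)"
      proof (subst (asm) ennreal_le_iff)
        show "0 \<le> (1 - t) * ((1 - t) * a + t * b) + t * ((1 - t) * b + t * c) + 2 * ((1 - t) * p + t * r)"
          using t a b c p r by simp
      qed
      then show "a + 2 * p \<le> (1 - t)\<^sup>2 * a + 2 * t * (1 - t) * b + t\<^sup>2 * c + 2 * (1 - t) * p + 2 * t * r"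
        by (simp add: power2_eq_square algebra_simps)
    qed
    then show ?thesis unfolding eq a(2) b(2) p(2) r(2) using a b p r
      by (simp add: ennreal_plus[symmetric] ennreal_leI del: ennreal_plus)
  qed
qed

text \<open>
  If the inequality failed on a set S of positive R-measure, then R conditioned on S, whose energy is
  still finite, would violate the integrated condition.
\<close>

lemma frostman_AE_ge:
  assumes P: "real_distribution P" and q[measurable]: "q \<in> borel_measurable borel"
    and fin: "field_energy d q P < \<infinity>"
    and min: "\<And>R. real_distribution R \<Longrightarrow> field_energy d q P \<le> field_energy d q R"
    and R: "real_distribution R" "mutual_energy d R R < \<infinity>" "(\<integral>\<^sup>+x. q x \<partial>R) < \<infinity>"
  shows "AE x in R. mutual_energy d P P + (\<integral>\<^sup>+x. q x \<partial>P) \<le> potential d P x + q x"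
proof (rule ccontr)
  interpret R: real_distribution R by fact
  note [measurable] = potential_measurable[OF P] potential_measurable[OF R(1)]
  define a where "a = mutual_energy d P P + (\<integral>\<^sup>+x. q x \<partial>P)"
  have a: "a < \<infinity>"
    using fin by (auto simp: a_def field_energy_def ennreal_mult_less_top)
  define S where "S = {x. potential d P x + q x < a}"
  have S[measurable]: "S \<in> sets borel" unfolding S_def by measurable
  assume "\<not> (AE x in R. mutual_energy d P P + (\<integral>\<^sup>+x. q x \<partial>P) \<le> potential d P x + q x)"
  then have "emeasure R S \<noteq> 0"
    by (subst (asm) AE_iff_measurable[of S]) (auto simp: S_def a_def not_le)
  then obtain m where m: "m > 0" "emeasure R S = ennreal m"
    by (metis R.emeasure_eq_measure ennreal_0 measure_nonneg order_le_less)
  define R' where "R' = uniform_measure R S"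
  have R': "real_distribution R'"
    unfolding R'_def using m by (intro real_distributionI prob_space_uniform_measure) auto
  interpret R': real_distribution R' by fact
  note [measurable] = potential_measurable[OF R']
  have le: "(\<integral>\<^sup>+x. f x \<partial>R') \<le> ennreal (1 / m) * (\<integral>\<^sup>+x. f x \<partial>R)" if [measurable]: "f \<in> borel_measurable borel" for f
  proof -
    have "(\<integral>\<^sup>+x. f x \<partial>R') = (\<integral>\<^sup>+x. f x * indicator S x \<partial>R) / ennreal m"
      unfolding R'_def by (subst nn_integral_uniform_measure) (auto simp: m)
    also have "\<dots> \<le> (\<integral>\<^sup>+x. f x \<partial>R) / ennreal m"
      by (intro divide_right_mono_ennreal nn_integral_mono) (auto simp: indicator_def)
    also have "\<dots> = ennreal (1 / m) * (\<integral>\<^sup>+x. f x \<partial>R)"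
      using m by (simp add: divide_ennreal_def inverse_ennreal inverse_eq_divide mult.commute)
    finally show ?thesis .
  qed
  have pot: "potential d R' x \<le> ennreal (1 / m) * potential d R x" for x
    unfolding potential_def by (rule le) measurable
  have "mutual_energy d R' R' \<le> ennreal (1 / m) * (\<integral>\<^sup>+x. potential d R' x \<partial>R)"
    unfolding mutual_energy_def by (rule le) measurable
  also have "\<dots> \<le> ennreal (1 / m) * (\<integral>\<^sup>+x. ennreal (1 / m) * potential d R x \<partial>R)"
    by (intro mult_left_mono nn_integral_mono pot) auto
  also have "\<dots> = ennreal (1 / m) * (ennreal (1 / m) * mutual_energy d R R)"
    unfolding mutual_energy_def by (subst nn_integral_cmult) auto
  also have "\<dots> < \<infinity>" using R(2) by (simp add: ennreal_mult_less_top)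
  finally have f1: "mutual_energy d R' R' < \<infinity>" .
  have "(\<integral>\<^sup>+x. q x \<partial>R') \<le> ennreal (1 / m) * (\<integral>\<^sup>+x. q x \<partial>R)" by (rule le) measurable
  also have "\<dots> < \<infinity>" using R(3) by (simp add: ennreal_mult_less_top)
  finally have f2: "(\<integral>\<^sup>+x. q x \<partial>R') < \<infinity>" .
  have "a \<le> (\<integral>\<^sup>+x. potential d P x + q x \<partial>R')"
    unfolding a_def by (rule frostman_integrated[OF P q fin min R' f1 f2])
  also have "\<dots> < (\<integral>\<^sup>+x. a \<partial>R')"
  proof (rule nn_integral_less)
    have AE: "AE x in R'. potential d P x + q x < a"
      unfolding R'_def by (rule AE_uniform_measureI) (auto simp: S_def)
    then show le: "AE x in R'. potential d P x + q x \<le> a" by eventually_elim simp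
    from nn_integral_mono_AE[OF le] have "(\<integral>\<^sup>+x. potential d P x + q x \<partial>R') \<le> a"
      using real_distributionD[OF R'] by simp
    then show "(\<integral>\<^sup>+x. potential d P x + q x \<partial>R') \<noteq> \<infinity>" using a by auto
    show "\<not> (AE x in R'. a \<le> potential d P x + q x)"
    proof
      assume "AE x in R'. a \<le> potential d P x + q x"
      with AE have "AE x in R'. False" by eventually_elim simp
      then show False using R'.AE_False by simp
    qed
  qed measurable
  also have "\<dots> = a" using real_distributionD[OF R'] by simp
  finally show False by simp
qed

text \<open>
  The P-integral of U^P + q is equal to its almost sure lower bound, so there is no room for larger values.
\<close>

lemma frostman_AE_le:
  assumes P: "real_distribution P" and q[measurable]: "q \<in> borel_measurable borel"
    and fin: "field_energy d q P < \<infinity>"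
    and min: "\<And>R. real_distribution R \<Longrightarrow> field_energy d q P \<le> field_energy d q R"
  shows "AE x in P. potential d P x + q x \<le> mutual_energy d P P + (\<integral>\<^sup>+x. q x \<partial>P)"
proof (rule ccontr)
  interpret P: real_distribution P by fact
  note [measurable] = potential_measurable[OF P]
  define a where "a = mutual_energy d P P + (\<integral>\<^sup>+x. q x \<partial>P)"
  have f: "mutual_energy d P P < \<infinity>" "(\<integral>\<^sup>+x. q x \<partial>P) < \<infinity>"
    using fin by (auto simp: field_energy_def ennreal_mult_less_top)
  assume *: "\<not> (AE x in P. potential d P x + q x \<le> mutual_energy d P P + (\<integral>\<^sup>+x. q x \<partial>P))"
  have "(\<integral>\<^sup>+x. a \<partial>P) < (\<integral>\<^sup>+x. potential d P x + q x \<partial>P)"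
  proof (rule nn_integral_less)
    show "AE x in P. a \<le> potential d P x + q x"
      unfolding a_def by (rule frostman_AE_ge[OF P q fin min P f])
    show "(\<integral>\<^sup>+x. a \<partial>P) \<noteq> \<infinity>" using f real_distributionD[OF P] by (auto simp: a_def)
  qed (use * in \<open>auto simp: a_def\<close>)
  also have "\<dots> = a" unfolding a_def mutual_energy_def by (rule nn_integral_add) measurable
  finally show False using real_distributionD[OF P] by simp
qed

text \<open>
  The points a and b are the ends of the gap of S that contains x. They both equal x if x lies in S,
  and both equal the extreme point of S if all of S is on one side of x; in the latter case monotonicity
  of K takes the place of convexity.
\<close>

lemma K_le_on_closed_set:
  assumes d: "d > 0" and S: "closed S" "S \<noteq> {}"
  shows "\<exists>a\<in>S. \<exists>b\<in>S. \<exists>t. 0 \<le> t \<and> t \<le> 1 \<and>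
    (\<forall>y\<in>S. K d (x - y) \<le> ennreal (1 - t) * K d (a - y) + ennreal t * K d (b - y))"
proof -
  have below: "\<exists>a\<in>S. a \<le> x \<and> (\<forall>y\<in>S. y \<le> x \<longrightarrow> y \<le> a)" if "\<exists>y\<in>S. y \<le> x"
  proof -
    let ?T = "S \<inter> {..x}"
    have T: "closed ?T" "?T \<noteq> {}" "bdd_above ?T" using S that by auto
    have "Sup ?T \<in> ?T" by (rule closed_contains_Sup[OF T(2,3,1)])
    moreover have "\<forall>y\<in>?T. y \<le> Sup ?T" using T(3) by (auto intro: cSup_upper)
    ultimately show ?thesis by (intro bexI[of _ "Sup ?T"]) auto
  qed
  have above: "\<exists>a\<in>S. x \<le> a \<and> (\<forall>y\<in>S. x \<le> y \<longrightarrow> a \<le> y)" if "\<exists>y\<in>S. x \<le> y"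
  proof -
    let ?T = "S \<inter> {x..}"
    have T: "closed ?T" "?T \<noteq> {}" "bdd_below ?T" using S that by auto
    have "Inf ?T \<in> ?T" by (rule closed_contains_Inf[OF T(2,3,1)])
    moreover have "\<forall>y\<in>?T. Inf ?T \<le> y" using T(3) by (auto intro: cInf_lower)
    ultimately show ?thesis by (intro bexI[of _ "Inf ?T"]) auto
  qed
  consider "\<exists>y\<in>S. y \<le> x" "\<exists>y\<in>S. x \<le> y" | "\<forall>y\<in>S. y < x" | "\<forall>y\<in>S. x < y" by (meson not_le)
  then show ?thesis
  proof cases
    case 1
    obtain a where a: "a \<in> S" "a \<le> x" "\<And>y. y \<in> S \<Longrightarrow> y \<le> x \<Longrightarrow> y \<le> a" using below[OF 1(1)] by blast
    obtain b where b: "b \<in> S" "x \<le> b" "\<And>y. y \<in> S \<Longrightarrow> x \<le> y \<Longrightarrow> b \<le> y" using above[OF 1(2)] by blast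
    define t where "t = (if a = b then 0 else (x - a) / (b - a))"
    have t: "0 \<le> t" "t \<le> 1" using a b by (auto simp: t_def field_simps)
    have "x = (1 - t) * a + t * b"
    proof (cases "a = b")
      case False
      then have "t * (b - a) = x - a" by (simp add: t_def)
      then show ?thesis by (simp add: algebra_simps)
    qed (use a b in \<open>auto simp: t_def\<close>)
    moreover have "y \<le> a \<and> y \<le> b \<or> a \<le> y \<and> b \<le> y" if "y \<in> S" for y
      using a b that by (meson linear order_trans)
    ultimately show ?thesis using K_convex_interval[OF d t] a(1) b(1) t by blast
  next
    case 2
    with S below obtain a where a: "a \<in> S" "\<forall>y\<in>S. y \<le> a" by (meson all_not_in_conv less_imp_le)
    then have "K d (x - y) \<le> K d (a - y)" if "y \<in> S" for y
      using that 2 by (intro K_antimono d) (auto intro: less_imp_le)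
    then show ?thesis using a by (intro bexI[of _ a] exI[of _ 0]) auto
  next
    case 3
    with S above obtain a where a: "a \<in> S" "\<forall>y\<in>S. a \<le> y" by (meson all_not_in_conv less_imp_le)
    then have "K d (x - y) \<le> K d (a - y)" if "y \<in> S" for y
      using that 3 by (subst (1 2) K_minus_commute, intro K_antimono d) (auto intro: less_imp_le)
    then show ?thesis using a by (intro bexI[of _ a] exI[of _ 0]) auto
  qed
qed

text \<open>
  The sublevel set of the potential is closed and carries P. Integrating the inequality for closed sets
  over P bounds the potential at x by a convex combination of two of its values on the sublevel set.
\<close>

lemma maximum_principle:
  assumes d: "d > 0" and P: "real_distribution P" and AE: "AE x in P. potential d P x \<le> \<rho>"
  shows "potential d P x \<le> \<rho>"
proof -
  interpret P: real_distribution P by fact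
  let ?S = "{x. potential d P x \<le> \<rho>}"
  have "closed ?S" by (rule closed_sublevel_seq_lsc[OF potential_seq_lsc[OF d P]])
  moreover have "?S \<noteq> {}" using AE P.AE_False by (force dest: AE_mp)
  ultimately obtain a b t where ab: "a \<in> ?S" "b \<in> ?S" and t: "0 \<le> t" "t \<le> 1"
    and le: "\<And>y. y \<in> ?S \<Longrightarrow> K d (x - y) \<le> ennreal (1 - t) * K d (a - y) + ennreal t * K d (b - y)"
    using K_le_on_closed_set[OF d] by meson
  have "potential d P x \<le> (\<integral>\<^sup>+y. ennreal (1 - t) * K d (a - y) + ennreal t * K d (b - y) \<partial>P)"
    unfolding potential_def by (rule nn_integral_mono_AE) (use AE in eventually_elim, auto intro: le)
  also have "\<dots> = ennreal (1 - t) * potential d P a + ennreal t * potential d P b"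
    unfolding potential_def by (simp add: nn_integral_add nn_integral_cmult)
  also have "\<dots> \<le> ennreal (1 - t) * \<rho> + ennreal t * \<rho>"
    using ab by (intro add_mono mult_left_mono) auto
  also have "\<dots> = \<rho>" using t by (simp add: distrib_right[symmetric] ennreal_plus[symmetric] del: ennreal_plus)
  finally show ?thesis .
qed

text \<open>
  The measure \<sigma> minimizes the energy without field among the probability measures on E, and \<rho> is its
  energy. The upper Frostman condition holds \<sigma>-almost everywhere, hence everywhere by the maximum
  principle; the lower one holds almost everywhere for each measure of finite energy on E.
\<close>

lemma equilibrium_measure_exists:
  assumes d: "d > 0" and E: "compact E"
    and P: "real_distribution P" "AE x in P. x \<in> E" "mutual_energy d P P < \<infinity>"
  shows "\<exists>\<sigma> \<rho>. real_distribution \<sigma> \<and> (AE x in \<sigma>. x \<in> E) \<and> (\<forall>x. potential d \<sigma> x \<le> \<rho>) \<and>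
    (AE x in P. \<rho> \<le> potential d \<sigma> x)"
proof -
  interpret P: real_distribution P by fact
  \<comment> \<open>an infinite wall outside E\<close>
  define q :: "real \<Rightarrow> ennreal" where "q x = (if x \<in> E then 0 else \<infinity>)" for x
  have "closed E" using E by (rule compact_imp_closed)
  have "seq_lsc q" unfolding seq_lsc_def
  proof (intro allI impI)
    fix X x assume X: "X \<longlonglongrightarrow> (x::real)"
    show "q x \<le> liminf (\<lambda>n. q (X n))"
    proof (cases "x \<in> E")
      case False
      then have "\<forall>\<^sub>F n in sequentially. X n \<in> - E"
        using X \<open>closed E\<close> by (intro topological_tendstoD) auto
      then have "\<forall>\<^sub>F n in sequentially. \<infinity> \<le> q (X n)" by eventually_elim (simp add: q_def)
      from Liminf_bounded[OF this] show ?thesis by (rule order_trans[rotated]) simp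
    qed (simp add: q_def)
  qed
  note q[measurable] = seq_lsc_measurable[OF this]
  have Eint: "(\<integral>\<^sup>+x. q x \<partial>P) = 0"
    using P(2) by (subst nn_integral_0_iff_AE) (auto simp: q_def)
  have coercive: "\<exists>R. \<forall>x. q x \<le> ennreal C \<longrightarrow> \<bar>x\<bar> \<le> R" for C
  proof -
    obtain R where "\<forall>x\<in>E. \<bar>x\<bar> \<le> R" using compact_imp_bounded[OF E] by (auto simp: bounded_iff)
    then show ?thesis by (intro exI[of _ R]) (auto simp: q_def top_unique split: if_splits)
  qed
  obtain \<sigma> where \<sigma>: "real_distribution \<sigma>" and fin: "field_energy d q \<sigma> < \<infinity>"
    and min: "\<And>R. real_distribution R \<Longrightarrow> field_energy d q \<sigma> \<le> field_energy d q R"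
  proof -
    have "field_energy d q P < \<infinity>" using P(3) Eint by (simp add: field_energy_def)
    from field_energy_minimizer_exists[OF d \<open>seq_lsc q\<close> coercive P(1) this] that show ?thesis by blast
  qed
  interpret \<sigma>: real_distribution \<sigma> by fact
  have "(\<integral>\<^sup>+x. q x \<partial>\<sigma>) \<noteq> \<infinity>" using fin by (auto simp: field_energy_def ennreal_mult_eq_top_iff)
  then have "AE x in \<sigma>. q x \<noteq> \<infinity>" by (intro nn_integral_noteq_infinite) auto
  then have \<sigma>E: "AE x in \<sigma>. x \<in> E" by eventually_elim (auto simp: q_def split: if_splits)
  then have Eint': "(\<integral>\<^sup>+x. q x \<partial>\<sigma>) = 0"
    by (subst nn_integral_0_iff_AE) (simp_all add: q_def)
  define \<rho> where "\<rho> = mutual_energy d \<sigma> \<sigma>"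
  have "AE x in \<sigma>. potential d \<sigma> x \<le> \<rho>"
  proof -
    have "AE x in \<sigma>. potential d \<sigma> x + q x \<le> mutual_energy d \<sigma> \<sigma> + (\<integral>\<^sup>+x. q x \<partial>\<sigma>)"
      by (rule frostman_AE_le[OF \<sigma> q fin]) (rule min)
    then show ?thesis unfolding Eint' \<rho>_def add_0_right
      by eventually_elim (erule order_trans[rotated], simp)
  qed
  from maximum_principle[OF d \<sigma> this] have "\<forall>x. potential d \<sigma> x \<le> \<rho>" by blast
  moreover have "AE x in P. \<rho> \<le> potential d \<sigma> x"
  proof -
    have "AE x in P. mutual_energy d \<sigma> \<sigma> + (\<integral>\<^sup>+x. q x \<partial>\<sigma>) \<le> potential d \<sigma> x + q x"
      by (rule frostman_AE_ge[OF \<sigma> q fin]) (use min P Eint in auto)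
    with P(2) show ?thesis unfolding Eint' \<rho>_def add_0_right by eventually_elim (simp add: q_def)
  qed
  ultimately show ?thesis using \<sigma> \<sigma>E by blast
qed

text \<open>
  With \<sigma> and \<rho> from the equilibrium problem on E, symmetry of the mutual energy gives that the
  \<sigma>-integral of U^N is the N-integral of U^\<sigma>, hence at most \<rho>, while the \<sigma>-integral of U^P is the
  P-integral of U^\<sigma>, hence at least \<rho>. Integrating both hypotheses over \<sigma>, which lives on E, finishes
  the proof.
\<close>

lemma potential_domination:
  assumes d: "d > 0" and E: "compact E" and q[measurable]: "q \<in> borel_measurable borel"
    and P: "real_distribution P" "AE x in P. x \<in> E" "mutual_energy d P P < \<infinity>"
    and N: "real_distribution N"
    and upper: "\<And>x. x \<in> E \<Longrightarrow> potential d P x + q x \<le> f"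
    and lower: "\<And>x. x \<in> E \<Longrightarrow> g \<le> potential d N x + q x"
  shows "g \<le> f"
proof -
  obtain \<sigma> \<rho> where \<sigma>: "real_distribution \<sigma>" "AE x in \<sigma>. x \<in> E" and le: "\<And>x. potential d \<sigma> x \<le> \<rho>"
    and ge: "AE x in P. \<rho> \<le> potential d \<sigma> x"
    using equilibrium_measure_exists[OF d E P] by blast
  interpret P: real_distribution P by fact
  interpret N: real_distribution N by fact
  interpret \<sigma>: real_distribution \<sigma> by fact
  note [measurable] = potential_measurable[OF P(1)] potential_measurable[OF N]
  note one = real_distributionD(4)[OF P(1)] real_distributionD(4)[OF N] real_distributionD(4)[OF \<sigma>(1)]
  have "mutual_energy d N \<sigma> \<le> (\<integral>\<^sup>+x. \<rho> \<partial>N)"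
    unfolding mutual_energy_def by (intro nn_integral_mono le)
  also have "\<dots> = (\<integral>\<^sup>+x. \<rho> \<partial>P)" by (simp add: one)
  also have "\<dots> \<le> mutual_energy d P \<sigma>"
    unfolding mutual_energy_def by (rule nn_integral_mono_AE[OF ge])
  finally have key: "mutual_energy d \<sigma> N \<le> mutual_energy d \<sigma> P"
    unfolding mutual_energy_commute[OF N \<sigma>(1)] mutual_energy_commute[OF P(1) \<sigma>(1)] .
  have "g = (\<integral>\<^sup>+x. g \<partial>\<sigma>)" by (simp add: one)
  also have "\<dots> \<le> (\<integral>\<^sup>+x. potential d N x + q x \<partial>\<sigma>)"
    by (rule nn_integral_mono_AE) (use \<sigma>(2) in eventually_elim, rule lower)
  also have "\<dots> = mutual_energy d \<sigma> N + (\<integral>\<^sup>+x. q x \<partial>\<sigma>)"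
    unfolding mutual_energy_def by (rule nn_integral_add) measurable
  also have "\<dots> \<le> mutual_energy d \<sigma> P + (\<integral>\<^sup>+x. q x \<partial>\<sigma>)" by (intro add_mono key) simp
  also have "\<dots> = (\<integral>\<^sup>+x. potential d P x + q x \<partial>\<sigma>)"
    unfolding mutual_energy_def by (rule nn_integral_add[symmetric]) measurable
  also have "\<dots> \<le> (\<integral>\<^sup>+x. f \<partial>\<sigma>)"
    by (rule nn_integral_mono_AE) (use \<sigma>(2) in eventually_elim, rule upper)
  also have "\<dots> = f" by (simp add: one)
  finally show ?thesis .
qed

section \<open>The external field of a weight function\<close>

lemma norm_integral_le_nn_integral:
  fixes f :: "real \<Rightarrow> complex"
  assumes "continuous_on {a..b} f"
  shows "ennreal (norm (integral {a..b} f)) \<le> (\<integral>\<^sup>+x\<in>{a..b}. ennreal (norm (f x)) \<partial>lborel)"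
proof -
  have int: "set_integrable lborel {a..b} f" by (rule borel_integrable_atLeastAtMost'[OF assms])
  then have "integral {a..b} f = (LINT x:{a..b}|lborel. f x)"
    by (simp add: set_borel_integral_eq_integral)
  also have "ennreal (norm \<dots>) \<le> (\<integral>\<^sup>+x. ennreal (norm (indicator {a..b} x *\<^sub>R f x)) \<partial>lborel)"
    unfolding set_lebesgue_integral_def
    by (rule integral_norm_bound_ennreal) (use int in \<open>simp add: set_integrable_def\<close>)
  also have "\<dots> = (\<integral>\<^sup>+x\<in>{a..b}. ennreal (norm (f x)) \<partial>lborel)"
    by (intro nn_integral_cong) (auto simp: indicator_def)
  finally show ?thesis .
qed

lemma contour_integral_vertical_le:
  assumes g: "continuous_on {z. Re z = c \<and> \<bar>Im z\<bar> \<le> b} g" and b: "0 < b"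
  shows "ennreal (norm (contour_integral (linepath (Complex c (-b)) (Complex c b)) g)) \<le>
    (\<integral>\<^sup>+y\<in>{-b..b}. ennreal (norm (g (Complex c y))) \<partial>lborel)"
proof -
  have "continuous_on {-b..b} (\<lambda>y. g (Complex c y))"
    by (rule continuous_on_compose2[OF g]) (auto intro!: continuous_intros simp: Complex_eq)
  from norm_integral_le_nn_integral[OF this] show ?thesis using b
    by (simp add: contour_integral_linepath_same_Re[of _ c _ "-b" b] norm_mult)
qed

lemma contour_integral_horizontal_le:
  assumes g: "continuous_on {z. Im z = c \<and> a \<le> Re z \<and> Re z \<le> b} g" and b: "a < b"
  shows "ennreal (norm (contour_integral (linepath (Complex a c) (Complex b c)) g)) \<le>
    (\<integral>\<^sup>+x\<in>{a..b}. ennreal (norm (g (Complex x c))) \<partial>lborel)"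
proof -
  have "continuous_on {a..b} (\<lambda>x. g (Complex x c))"
    by (rule continuous_on_compose2[OF g]) (auto intro!: continuous_intros simp: Complex_eq)
  note * = norm_integral_le_nn_integral[OF this]
  have "linepath (Complex a c) (Complex b c) t = linepath (of_real a) (of_real b) t + Complex 0 c" for t
    by (simp add: linepath_def complex_eq_iff algebra_simps)
  moreover have "Complex b c - Complex a c = of_real b - of_real a" by (simp add: complex_eq_iff)
  ultimately have "contour_integral (linepath (Complex a c) (Complex b c)) g =
      contour_integral (linepath (of_real a) (of_real b)) (\<lambda>z. g (z + Complex 0 c))"
    by (simp add: contour_integral_integral)
  also have "\<dots> = integral {a..b} (\<lambda>x. g (of_real x + Complex 0 c))"
    using b by (subst contour_integral_linepath_Reals_eq) auto
  also have "\<dots> = integral {a..b} (\<lambda>x. g (Complex x c))"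
    by (intro integral_cong arg_cong[where f=g]) (simp add: complex_eq_iff)
  finally show ?thesis using * by simp
qed

lemma convex_strip: "convex (strip d)"
proof -
  have "strip d = {z. Im z < d} \<inter> {z. Im z > - d}" by (auto simp: strip_def)
  then show ?thesis by (simp add: convex_Int convex_halfspace_Im_lt convex_halfspace_Im_gt)
qed

lemma open_strip: "open (strip d)"
proof -
  have "strip d = {z. Im z < d} \<inter> {z. Im z > - d}" by (auto simp: strip_def)
  then show ?thesis by (simp add: open_Int open_halfspace_Im_lt open_halfspace_Im_gt)
qed

lemma measurable_horizontal_line:
  assumes "w holomorphic_on strip d" "\<bar>c\<bar> < d"
  shows "(\<lambda>t. w (Complex t c)) \<in> borel_measurable borel"
proof -
  have "continuous_on UNIV (\<lambda>t. w (Complex t c))"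
    by (rule continuous_on_compose2[OF holomorphic_on_imp_continuous_on[OF assms(1)]])
       (use assms(2) in \<open>auto simp: strip_def Complex_eq intro!: continuous_intros\<close>)
  then show ?thesis by (rule borel_measurable_continuous_onI)
qed

text \<open>
  Cauchy's integral formula for the rectangle with corners x \<plusminus> 1 \<plusminus> ib. The denominator of the Cauchy
  kernel is at least 1 in modulus on the vertical sides and at least b on the horizontal ones.
\<close>

lemma cauchy_rectangle_bound:
  assumes w: "w holomorphic_on strip d" and b: "0 < b" "b < d"
  shows "ennreal (2 * pi * norm (w (of_real x))) \<le>
    (\<integral>\<^sup>+y\<in>{-d<..<d}. ennreal (norm (w (Complex (x + 1) y))) \<partial>lborel) +
    (\<integral>\<^sup>+y\<in>{-d<..<d}. ennreal (norm (w (Complex (x - 1) y))) \<partial>lborel) +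
    ennreal (1 / b) * ((\<integral>\<^sup>+t\<in>{x-1..x+1}. ennreal (norm (w (Complex t b))) \<partial>lborel) +
    (\<integral>\<^sup>+t\<in>{x-1..x+1}. ennreal (norm (w (Complex t (-b)))) \<partial>lborel))"
proof -
  let ?g = "\<lambda>z. w z / (z - of_real x)"
  define p1 where "p1 = Complex (x - 1) (-b)"
  define p2 where "p2 = Complex (x + 1) (-b)"
  define p3 where "p3 = Complex (x + 1) b"
  define p4 where "p4 = Complex (x - 1) b"
  note p_defs = p1_def p2_def p3_def p4_def
  have inbox: "complex_of_real x \<in> box p1 p3" using b by (simp add: in_box_complex_iff p_defs)
  have cbox: "cbox p1 p3 \<subseteq> strip d" using b by (auto simp: in_cbox_complex_iff strip_def p_defs)
  have img: "path_image (rectpath p1 p3) \<subseteq> strip d - {of_real x}"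
    using path_image_rectpath_cbox_minus_box[of p1 p3] inbox cbox b by (auto simp: p_defs)
  have "(?g has_contour_integral (2 * pi * \<i> * winding_number (rectpath p1 p3) (of_real x) * w (of_real x))) (rectpath p1 p3)"
    by (rule Cauchy_integral_formula_convex_simple[OF convex_strip w _ _ img])
       (use b interior_open[OF open_strip] in \<open>auto simp: strip_def\<close>)
  then have ci: "(?g has_contour_integral (2 * pi * \<i> * w (of_real x))) (rectpath p1 p3)"
    by (simp add: winding_number_rectpath[OF inbox])
  have rect: "rectpath p1 p3 = linepath p1 p2 +++ linepath p2 p3 +++ linepath p3 p4 +++ linepath p4 p1"
    by (simp add: rectpath_def Let_def p_defs)
  have contg: "continuous_on (strip d - {of_real x}) ?g"
    by (intro continuous_intros holomorphic_on_imp_continuous_on holomorphic_on_subset[OF w]) auto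
  have rev: "contour_integral (linepath u v) ?g = - contour_integral (linepath v u) ?g"
    if "closed_segment u v \<subseteq> strip d - {of_real x}" for u v
    by (rule contour_integral_reverse_linepath[OF continuous_on_subset[OF contg that]])
  have ints: "?g contour_integrable_on linepath p1 p2" "?g contour_integrable_on linepath p2 p3"
     "?g contour_integrable_on linepath p3 p4" "?g contour_integrable_on linepath p4 p1"
    using has_contour_integral_integrable[OF ci] unfolding rect by auto
  have "2 * pi * \<i> * w (of_real x) = contour_integral (rectpath p1 p3) ?g"
    using contour_integral_unique[OF ci] by simp
  also have "\<dots> = contour_integral (linepath p1 p2) ?g + contour_integral (linepath p2 p3) ?g
      + contour_integral (linepath p3 p4) ?g + contour_integral (linepath p4 p1) ?g"
    unfolding rect using ints by simp
  also have "contour_integral (linepath p3 p4) ?g = - contour_integral (linepath p4 p3) ?g"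
    by (rule rev) (use img in \<open>auto simp: rect path_image_join\<close>)
  also have "contour_integral (linepath p4 p1) ?g = - contour_integral (linepath p1 p4) ?g"
    by (rule rev) (use img in \<open>auto simp: rect path_image_join\<close>)
  finally have eq: "2 * pi * \<i> * w (of_real x) = contour_integral (linepath p1 p2) ?g + contour_integral (linepath p2 p3) ?g
      + - contour_integral (linepath p4 p3) ?g + - contour_integral (linepath p1 p4) ?g" .
  have tri: "norm (A + B + - C + - D) \<le> norm A + norm B + norm C + norm D" for A B C D :: complex by norm
  have "norm (2 * pi * \<i> * w (of_real x)) \<le>
      norm (contour_integral (linepath p1 p2) ?g) + norm (contour_integral (linepath p2 p3) ?g)
      + norm (contour_integral (linepath p4 p3) ?g) + norm (contour_integral (linepath p1 p4) ?g)"
    unfolding eq by (rule tri)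
  then have "ennreal (2 * pi * norm (w (of_real x))) \<le>
      ennreal (norm (contour_integral (linepath p1 p2) ?g) + norm (contour_integral (linepath p2 p3) ?g)
      + norm (contour_integral (linepath p4 p3) ?g) + norm (contour_integral (linepath p1 p4) ?g))"
    by (intro ennreal_leI) (simp add: norm_mult)
  also have "\<dots> = ennreal (norm (contour_integral (linepath p2 p3) ?g)) + ennreal (norm (contour_integral (linepath p1 p4) ?g))
      + (ennreal (norm (contour_integral (linepath p4 p3) ?g)) + ennreal (norm (contour_integral (linepath p1 p2) ?g)))"
    by (simp add: ac_simps)
  also have "\<dots> \<le> (\<integral>\<^sup>+y\<in>{-d<..<d}. ennreal (norm (w (Complex (x + 1) y))) \<partial>lborel) +
    (\<integral>\<^sup>+y\<in>{-d<..<d}. ennreal (norm (w (Complex (x - 1) y))) \<partial>lborel) +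
    (ennreal (1 / b) * (\<integral>\<^sup>+t\<in>{x-1..x+1}. ennreal (norm (w (Complex t b))) \<partial>lborel) +
    ennreal (1 / b) * (\<integral>\<^sup>+t\<in>{x-1..x+1}. ennreal (norm (w (Complex t (-b)))) \<partial>lborel))"
  proof -
    have vert: "ennreal (norm (contour_integral (linepath (Complex c (-b)) (Complex c b)) ?g)) \<le>
       (\<integral>\<^sup>+y\<in>{-d<..<d}. ennreal (norm (w (Complex c y))) \<partial>lborel)" if c: "\<bar>c - x\<bar> = 1" for c
    proof -
      have "continuous_on {z. Re z = c \<and> \<bar>Im z\<bar> \<le> b} ?g"
        using c b by (intro continuous_on_subset[OF contg]) (auto simp: strip_def)
      from contour_integral_vertical_le[OF this b(1)]
      have "ennreal (norm (contour_integral (linepath (Complex c (-b)) (Complex c b)) ?g)) \<le>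
        (\<integral>\<^sup>+y\<in>{-b..b}. ennreal (norm (?g (Complex c y))) \<partial>lborel)" .
      also have "\<dots> \<le> (\<integral>\<^sup>+y\<in>{-d<..<d}. ennreal (norm (w (Complex c y))) \<partial>lborel)"
      proof (intro nn_integral_mono mult_mono ennreal_leI)
        fix y
        have "1 \<le> norm (Complex c y - of_real x)"
          using abs_Re_le_cmod[of "Complex c y - of_real x"] c by simp
        then show "norm (?g (Complex c y)) \<le> norm (w (Complex c y))"
          by (simp add: norm_divide divide_le_eq mult_le_cancel_left1 del: One_nat_def)
      qed (use b in \<open>auto simp: indicator_def\<close>)
      finally show ?thesis .
    qed
    have hor: "ennreal (norm (contour_integral (linepath (Complex (x - 1) c) (Complex (x + 1) c)) ?g)) \<le>
       ennreal (1 / b) * (\<integral>\<^sup>+t\<in>{x-1..x+1}. ennreal (norm (w (Complex t c))) \<partial>lborel)" if c: "\<bar>c\<bar> = b" for c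
    proof -
      have "continuous_on {z. Im z = c \<and> x - 1 \<le> Re z \<and> Re z \<le> x + 1} ?g"
        using c b by (intro continuous_on_subset[OF contg]) (auto simp: strip_def)
      from contour_integral_horizontal_le[OF this]
      have "ennreal (norm (contour_integral (linepath (Complex (x - 1) c) (Complex (x + 1) c)) ?g)) \<le>
        (\<integral>\<^sup>+t\<in>{x-1..x+1}. ennreal (norm (?g (Complex t c))) \<partial>lborel)" by simp
      also have "\<dots> \<le> (\<integral>\<^sup>+t. ennreal (1 / b) * (ennreal (norm (w (Complex t c))) * indicator {x-1..x+1} t) \<partial>lborel)"
      proof (intro nn_integral_mono)
        fix t
        have "b \<le> norm (Complex t c - of_real x)"
          using abs_Im_le_cmod[of "Complex t c - of_real x"] c by simp
        then have "norm (?g (Complex t c)) \<le> 1 / b * norm (w (Complex t c))"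
          unfolding norm_divide using frac_le[OF norm_ge_zero order_refl b(1)] by simp
        then have "ennreal (norm (?g (Complex t c))) \<le> ennreal (1 / b) * ennreal (norm (w (Complex t c)))"
          using b by (subst ennreal_mult[symmetric]) (auto intro: ennreal_leI)
        then show "ennreal (norm (?g (Complex t c))) * indicator {x-1..x+1} t \<le>
           ennreal (1 / b) * (ennreal (norm (w (Complex t c))) * indicator {x-1..x+1} t)"
          by (simp add: indicator_def)
      qed
      also have "\<dots> = ennreal (1 / b) * (\<integral>\<^sup>+t\<in>{x-1..x+1}. ennreal (norm (w (Complex t c))) \<partial>lborel)"
      proof (rule nn_integral_cmult)
        have [measurable]: "(\<lambda>t. w (Complex t c)) \<in> borel_measurable borel"
          by (rule measurable_horizontal_line[OF w]) (use c b in simp)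
        show "(\<lambda>t. ennreal (norm (w (Complex t c))) * indicator {x-1..x+1} t) \<in> borel_measurable lborel"
          by measurable
      qed
      finally show ?thesis .
    qed
    show ?thesis unfolding p_defs using b by (intro add_mono vert hor) auto
  qed
  finally show ?thesis by (simp add: distrib_left)
qed


lemma weight_functionD:
  assumes "weight_function d w"
  shows "w holomorphic_on strip d"
    and "w (of_real x) \<in> of_real ` {0<..1::real}"
    and "((\<lambda>x. \<integral>\<^sup>+y\<in>{-d<..<d}. ennreal (norm (w (Complex x y))) \<partial>lborel) \<longlongrightarrow> 0) at_top"
    and "((\<lambda>x. \<integral>\<^sup>+y\<in>{-d<..<d}. ennreal (norm (w (Complex x y))) \<partial>lborel) \<longlongrightarrow> 0) at_bot"
    and "\<exists>L::ennreal. L < \<infinity> \<and>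
        ((\<lambda>y. \<integral>\<^sup>+x. ennreal (norm (w (Complex x y)) + norm (w (Complex x (-y)))) \<partial>lborel)
           \<longlongrightarrow> L) (at_left d)"
    and "strictly_concave_on UNIV (\<lambda>x. ln (Re (w (of_real x))))"
  using assms unfolding weight_function_def by (auto intro: analytic_imp_holomorphic)

text \<open>Dominated convergence: each fixed t leaves the moving window eventually.\<close>

lemma nn_integral_window_tendsto_0:
  fixes g :: "real \<Rightarrow> ennreal"
  assumes [measurable]: "g \<in> borel_measurable borel" and fin: "(\<integral>\<^sup>+x. g x \<partial>lborel) < \<infinity>"
    and X: "filterlim (\<lambda>n. \<bar>X n\<bar>) at_top sequentially"
  shows "(\<lambda>n. \<integral>\<^sup>+t\<in>{X n - 1..X n + 1}. g t \<partial>lborel) \<longlonglongrightarrow> 0"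
proof -
  have "(\<lambda>n. \<integral>\<^sup>+t\<in>{X n - 1..X n + 1}. g t \<partial>lborel) \<longlonglongrightarrow> (\<integral>\<^sup>+t. 0 \<partial>(lborel :: real measure))"
  proof (rule nn_integral_dominated_convergence[where w=g])
    show "AE t in lborel. (\<lambda>n. g t * indicator {X n - 1..X n + 1} t) \<longlonglongrightarrow> 0"
    proof (rule AE_I2)
      fix t
      have "\<forall>\<^sub>F n in sequentially. \<bar>t\<bar> + 2 \<le> \<bar>X n\<bar>" using X by (simp add: filterlim_at_top)
      then have "\<forall>\<^sub>F n in sequentially. g t * indicator {X n - 1..X n + 1} t = 0"
        by eventually_elim (auto simp: indicator_def)
      then show "(\<lambda>n. g t * indicator {X n - 1..X n + 1} t) \<longlonglongrightarrow> 0"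
        by (rule tendsto_eventually)
    qed
    show "AE x in lborel. g x * indicator {X j - 1..X j + 1} x \<le> g x" for j
      by (auto simp: indicator_def)
  qed (use fin in auto)
  then show ?thesis by simp
qed

text \<open>
  The two integrability conditions on w match the two kinds of sides of the rectangle: the integrals
  over the vertical sides tend to 0 by hypothesis, and for a height b close to d the horizontal sides
  carry windows of a convergent integral.
\<close>

lemma weight_seq_tendsto_0:
  assumes d: "d > 0" and wf: "weight_function d w"
    and X: "filterlim (\<lambda>n. \<bar>X n\<bar>) at_top sequentially"
    and V: "\<And>c. (\<lambda>n. \<integral>\<^sup>+y\<in>{-d<..<d}. ennreal (norm (w (Complex (X n + c) y))) \<partial>lborel) \<longlonglongrightarrow> 0"
  shows "(\<lambda>n. w (of_real (X n))) \<longlonglongrightarrow> 0"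
proof -
  note W = weight_functionD[OF wf]
  obtain L :: ennreal where L: "L < \<infinity>"
    "((\<lambda>y. \<integral>\<^sup>+x. ennreal (norm (w (Complex x y)) + norm (w (Complex x (-y)))) \<partial>lborel) \<longlongrightarrow> L) (at_left d)"
    using W(5) by blast
  have "\<forall>\<^sub>F y in at_left d. (\<integral>\<^sup>+x. ennreal (norm (w (Complex x y)) + norm (w (Complex x (-y)))) \<partial>lborel) < \<infinity>"
    by (rule order_tendstoD(2)[OF L(2,1)])
  moreover have "\<forall>\<^sub>F y in at_left d. 0 < y \<and> y < d"
    using eventually_at_left_real[OF d] by eventually_elim simp
  ultimately have "\<forall>\<^sub>F y in at_left d. 0 < y \<and> y < d \<and>
      (\<integral>\<^sup>+x. ennreal (norm (w (Complex x y)) + norm (w (Complex x (-y)))) \<partial>lborel) < \<infinity>"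
    by eventually_elim simp
  \<comment> \<open>the half-height of the rectangle\<close>
  then obtain b where b: "0 < b" "b < d"
    "(\<integral>\<^sup>+x. ennreal (norm (w (Complex x b)) + norm (w (Complex x (-b)))) \<partial>lborel) < \<infinity>"
    using eventually_happens[of _ "at_left d"] trivial_limit_at_left_real by blast
  have fin: "(\<integral>\<^sup>+x. ennreal (norm (w (Complex x c))) \<partial>lborel) < \<infinity>" if "\<bar>c\<bar> = b" for c
  proof -
    have "c = b \<or> c = - b" using that by auto
    then have "(\<integral>\<^sup>+x. ennreal (norm (w (Complex x c))) \<partial>lborel) \<le>
      (\<integral>\<^sup>+x. ennreal (norm (w (Complex x b)) + norm (w (Complex x (-b)))) \<partial>lborel)"
      by (intro nn_integral_mono ennreal_leI) auto
    then show ?thesis using b(3) by simp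
  qed
  have win: "(\<lambda>n. \<integral>\<^sup>+t\<in>{X n - 1..X n + 1}. ennreal (norm (w (Complex t c))) \<partial>lborel) \<longlonglongrightarrow> 0" if "\<bar>c\<bar> = b" for c
  proof (rule nn_integral_window_tendsto_0[OF _ fin[OF that] X])
    have "(\<lambda>t. w (Complex t c)) \<in> borel_measurable borel"
      using measurable_horizontal_line[OF W(1)] that b by simp
    then show "(\<lambda>t. ennreal (norm (w (Complex t c)))) \<in> borel_measurable borel" by measurable
  qed
  define B where "B n = (\<integral>\<^sup>+y\<in>{-d<..<d}. ennreal (norm (w (Complex (X n + 1) y))) \<partial>lborel) +
    (\<integral>\<^sup>+y\<in>{-d<..<d}. ennreal (norm (w (Complex (X n - 1) y))) \<partial>lborel) +
    ennreal (1 / b) * ((\<integral>\<^sup>+t\<in>{X n-1..X n+1}. ennreal (norm (w (Complex t b))) \<partial>lborel) +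
    (\<integral>\<^sup>+t\<in>{X n-1..X n+1}. ennreal (norm (w (Complex t (-b)))) \<partial>lborel))" for n
  have "B \<longlonglongrightarrow> 0 + 0 + ennreal (1 / b) * (0 + 0)"
    unfolding B_def[abs_def]
  proof (intro tendsto_add ennreal_tendsto_cmult win)
    show "(\<lambda>n. \<integral>\<^sup>+y\<in>{-d<..<d}. ennreal (norm (w (Complex (X n - 1) y))) \<partial>lborel) \<longlonglongrightarrow> 0"
      using V[of "-1"] by simp
  qed (use V[of 1] b in simp_all)
  then have B: "B \<longlonglongrightarrow> 0" by simp
  have le: "ennreal (2 * pi * norm (w (of_real (X n)))) \<le> B n" for n
    unfolding B_def by (rule cauchy_rectangle_bound[OF W(1) b(1,2)])
  have "(\<lambda>n. ennreal (2 * pi * norm (w (of_real (X n))))) \<longlonglongrightarrow> 0"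
    by (rule tendsto_sandwich[OF _ _ tendsto_const B]) (simp_all add: le)
  then have "(\<lambda>n. ennreal (2 * pi * norm (w (of_real (X n))))) \<longlonglongrightarrow> ennreal 0"
    unfolding ennreal_0 .
  then have "(\<lambda>n. 2 * pi * norm (w (of_real (X n)))) \<longlonglongrightarrow> 0"
    by (rule tendsto_ennrealD) simp_all
  then have "(\<lambda>n. (1 / (2 * pi)) * (2 * pi * norm (w (of_real (X n))))) \<longlonglongrightarrow> (1 / (2 * pi)) * 0"
    by (intro tendsto_intros)
  then show ?thesis by (simp add: tendsto_norm_zero_iff)
qed

lemma weight_tendsto_0:
  assumes d: "d > 0" and wf: "weight_function d w"
    and X: "filterlim X at_top sequentially \<or> filterlim X at_bot sequentially"
  shows "(\<lambda>n. w (of_real (X n))) \<longlonglongrightarrow> 0"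
proof (rule weight_seq_tendsto_0[OF d wf])
  note W = weight_functionD[OF wf]
  show "filterlim (\<lambda>n. \<bar>X n\<bar>) at_top sequentially"
    using X
  proof
    assume "filterlim X at_top sequentially"
    then show ?thesis by (rule filterlim_at_top_mono) (rule always_eventually, rule allI, linarith)
  next
    assume "filterlim X at_bot sequentially"
    then have "filterlim (\<lambda>n. - X n) at_top sequentially" by (simp add: filterlim_uminus_at_bot)
    then show ?thesis by (rule filterlim_at_top_mono) (rule always_eventually, rule allI, linarith)
  qed
  show "(\<lambda>n. \<integral>\<^sup>+y\<in>{-d<..<d}. ennreal (norm (w (Complex (X n + c) y))) \<partial>lborel) \<longlonglongrightarrow> 0" for c
    using X
  proof
    assume "filterlim X at_top sequentially"
    then have "filterlim (\<lambda>n. X n + c) at_top sequentially"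
      using filterlim_tendsto_add_at_top[OF tendsto_const[of c]] by (simp add: add.commute)
    then show ?thesis by (rule filterlim_compose[OF W(3)])
  next
    assume "filterlim X at_bot sequentially"
    then have "filterlim (\<lambda>n. - c + - X n) at_top sequentially"
      by (intro filterlim_tendsto_add_at_top[OF tendsto_const]) (simp add: filterlim_uminus_at_bot)
    then have "filterlim (\<lambda>n. X n + c) at_bot sequentially"
      by (simp add: filterlim_uminus_at_bot add.commute)
    then show ?thesis by (rule filterlim_compose[OF W(4)])
  qed
qed

lemma weight_real:
  assumes "weight_function d w"
  shows "0 < Re (w (of_real x))" "Re (w (of_real x)) \<le> 1" "norm (w (of_real x)) = Re (w (of_real x))"
  using weight_functionD(2)[OF assms, of x] by auto

lemma Q_nonneg:
  assumes "weight_function d w"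
  shows "0 \<le> Q w x"
  using weight_real[OF assms, of x] by (simp add: Q_def ln_le_zero_iff)

lemma Q_convex:
  assumes "weight_function d w"
  shows "convex_on UNIV (Q w)"
proof (rule convex_onI)
  fix t x y :: real assume t: "0 < t" "t < 1"
  show "Q w ((1 - t) *\<^sub>R x + t *\<^sub>R y) \<le> (1 - t) * Q w x + t * Q w y"
  proof (cases "x = y")
    case True
    then show ?thesis by (simp add: algebra_simps)
  next
    case False
    then have "(1 - t) * ln (Re (w (of_real x))) + t * ln (Re (w (of_real y))) < ln (Re (w (of_real ((1 - t) * x + t * y))))"
      using weight_functionD(6)[OF assms] t unfolding strictly_concave_on_def by blast
    then show ?thesis by (simp add: Q_def)
  qed
qed simp

lemma Q_continuous:
  assumes "weight_function d w"
  shows "continuous_on UNIV (Q w)"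
  using convex_on_continuous[OF open_UNIV Q_convex[OF assms]] .

text \<open>
  Concavity of ln w alone would not give this, since Q could be bounded on a half-line; it is the decay of w that counts.
\<close>

lemma Q_coercive:
  assumes d: "d > 0" and wf: "weight_function d w"
  shows "\<exists>R. \<forall>x. Q w x \<le> C \<longrightarrow> \<bar>x\<bar> \<le> R"
proof -
  have no: False if X: "filterlim X at_top sequentially \<or> filterlim X at_bot sequentially"
    and C: "\<And>n. Q w (X n) \<le> C" for X :: "nat \<Rightarrow> real"
  proof -
    have "(\<lambda>n. norm (w (of_real (X n)))) \<longlonglongrightarrow> 0"
      using weight_tendsto_0[OF d wf X] by (rule tendsto_norm_zero)
    moreover have "exp (- C) \<le> norm (w (of_real (X n)))" for n
    proof -
      have "- C \<le> ln (Re (w (of_real (X n))))" using C[of n] by (simp add: Q_def)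
      then have "exp (- C) \<le> exp (ln (Re (w (of_real (X n)))))" by simp
      then show ?thesis using weight_real[OF wf, of "X n"] by simp
    qed
    ultimately have "exp (- C) \<le> 0" by (intro LIMSEQ_le_const) auto
    then show False by (simp add: not_le)
  qed
  have "\<exists>R. \<forall>x. Q w x \<le> C \<longrightarrow> x \<le> R"
  proof (rule ccontr)
    assume "\<not> ?thesis"
    then have "\<forall>n::nat. \<exists>x. Q w x \<le> C \<and> real n < x" by (meson not_le)
    then obtain X where "\<And>n::nat. Q w (X n) \<le> C \<and> real n < X n" by metis
    moreover from this have "filterlim X at_top sequentially"
      by (intro filterlim_at_top_mono[OF filterlim_real_sequentially]) (auto intro: always_eventually less_imp_le)
    ultimately show False using no by blast
  qed
  moreover have "\<exists>R. \<forall>x. Q w x \<le> C \<longrightarrow> R \<le> x"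
  proof (rule ccontr)
    assume "\<not> ?thesis"
    then have "\<forall>n::nat. \<exists>x. Q w x \<le> C \<and> x < - real n" by (meson not_le)
    then obtain X where X: "\<And>n::nat. Q w (X n) \<le> C \<and> X n < - real n" by metis
    have "filterlim (\<lambda>n. - X n) at_top sequentially"
    proof (rule filterlim_at_top_mono[OF filterlim_real_sequentially], intro always_eventually allI)
      show "real n \<le> - X n" for n using X[of n] by linarith
    qed
    then have "filterlim X at_bot sequentially" by (simp add: filterlim_uminus_at_bot)
    then show False using no X by blast
  qed
  ultimately obtain R1 R2 where "\<forall>x. Q w x \<le> C \<longrightarrow> x \<le> R1" "\<forall>x. Q w x \<le> C \<longrightarrow> R2 \<le> x" by blast
  then show ?thesis by (intro exI[of _ "\<bar>R1\<bar> + \<bar>R2\<bar>"]) force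
qed

text \<open>
  By convexity Q lies below its chord, and the mean of the chord is the mean of the two end values.
\<close>

lemma Q_average_le:
  assumes wf: "weight_function d w"
  shows "2 * (\<integral>\<^sup>+s. ennreal (Q w (a + s * (b - a))) \<partial>U01) \<le> ennreal (Q w a) + ennreal (Q w b)"
proof -
  let ?g = "\<lambda>s. (1 - s) * Q w a + s * Q w b"
  note nn = Q_nonneg[OF wf]
  have Qm: "Q w \<in> borel_measurable borel"
    using Q_continuous[OF wf] by (rule borel_measurable_continuous_onI)
  have "(?g has_integral ((1 * Q w a + 1\<^sup>2 / 2 * (Q w b - Q w a)) - (0 * Q w a + 0\<^sup>2 / 2 * (Q w b - Q w a)))) {0..1}"
    by (rule fundamental_theorem_of_calculus)
       (auto intro!: derivative_eq_intros simp: has_real_derivative_iff_has_vector_derivative[symmetric] field_simps)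
  then have "(?g has_integral (Q w a + Q w b) / 2) {0<..<1}"
    by (simp add: has_integral_Icc_iff_Ioo field_simps)
  from nn_integral_has_integral_lebesgue[OF _ this]
  have "(\<integral>\<^sup>+s. ennreal (indicator {0<..<1} s * ?g s) \<partial>lborel) = ennreal ((Q w a + Q w b) / 2)"
    using nn by simp
  also have "(\<lambda>s. ennreal (indicator {0<..<1} s * ?g s)) = (\<lambda>s. ennreal (?g s) * indicator {0<..<1} s)"
    by (auto simp: indicator_def)
  also have "(\<integral>\<^sup>+s. ennreal (?g s) * indicator {0<..<1} s \<partial>lborel) = (\<integral>\<^sup>+s. ennreal (?g s) \<partial>U01)"
    by (rule nn_integral_U01[symmetric]) measurable
  finally have int: "(\<integral>\<^sup>+s. ennreal (?g s) \<partial>U01) = ennreal ((Q w a + Q w b) / 2)" .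
  have "(\<integral>\<^sup>+s. ennreal (Q w (a + s * (b - a))) \<partial>U01) \<le> (\<integral>\<^sup>+s. ennreal (?g s) \<partial>U01)"
  proof (rule nn_integral_mono_AE)
    show "AE s in U01. ennreal (Q w (a + s * (b - a))) \<le> ennreal (?g s)"
      using AE_U01
    proof eventually_elim
      case (elim s)
      then have "Q w ((1 - s) *\<^sub>R a + s *\<^sub>R b) \<le> ?g s"
        by (intro convex_onD[OF Q_convex[OF wf]]) auto
      then show ?case by (intro ennreal_leI) (simp add: algebra_simps)
    qed
  qed
  then have "2 * (\<integral>\<^sup>+s. ennreal (Q w (a + s * (b - a))) \<partial>U01) \<le> 2 * ennreal ((Q w a + Q w b) / 2)"
    unfolding int by (rule mult_left_mono) simp
  also have "\<dots> = ennreal (2 * ((Q w a + Q w b) / 2))"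
    using nn by (subst ennreal_mult) (simp_all del: ennreal_plus)
  also have "2 * ((Q w a + Q w b) / 2) = Q w a + Q w b" by simp
  also have "ennreal (Q w a + Q w b) = ennreal (Q w a) + ennreal (Q w b)" by (rule ennreal_plus[OF nn nn])
  finally show ?thesis .
qed

section \<open>Discrete minimizers\<close>

text \<open>
  The discrete energy depends only on the set of points. In this form replacing one point by another
  needs no reordering. The weight c of the field is 2(n-1)/n for the energy and half of that for F_D.
\<close>

definition point_energy :: "real \<Rightarrow> (complex \<Rightarrow> complex) \<Rightarrow> ennreal \<Rightarrow> real set \<Rightarrow> ennreal" where
  "point_energy d w c S = (\<Sum>p\<in>S. \<Sum>q\<in>S - {p}. K d (p - q)) + c * (\<Sum>p\<in>S. ennreal (Q w p))"

lemma sum_pairs_list: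
  fixes g :: "'a \<Rightarrow> 'a \<Rightarrow> 'b::comm_monoid_add"
  assumes "distinct a" "length a = n"
  shows "(\<Sum>(i, j) \<in> {(i, j). i < n \<and> j < n \<and> i \<noteq> j}. g (a ! i) (a ! j)) = (\<Sum>p\<in>set a. \<Sum>q\<in>set a - {p}. g p q)"
proof -
  have bij: "bij_betw ((!) a) {..<n} (set a)" by (rule bij_betw_nth) (use assms in auto)
  have bij': "bij_betw ((!) a) ({..<n} - {i}) (set a - {a ! i})" if "i < n" for i
    by (rule bij_betw_DiffI[OF bij]) (use that assms in \<open>auto simp: bij_betw_def\<close>)
  have "{(i, j). i < n \<and> j < n \<and> i \<noteq> j} = Sigma {..<n} (\<lambda>i. {..<n} - {i})" by auto
  then have "(\<Sum>(i, j) \<in> {(i, j). i < n \<and> j < n \<and> i \<noteq> j}. g (a ! i) (a ! j)) = (\<Sum>i<n. \<Sum>j\<in>{..<n} - {i}. g (a ! i) (a ! j))"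
    by (simp add: sum.Sigma)
  also have "\<dots> = (\<Sum>i<n. \<Sum>q\<in>set a - {a ! i}. g (a ! i) q)"
    by (intro sum.cong refl sum.reindex_bij_betw bij') simp
  also have "\<dots> = (\<Sum>p\<in>set a. \<Sum>q\<in>set a - {p}. g p q)"
    by (rule sum.reindex_bij_betw[OF bij])
  finally show ?thesis .
qed

lemma sum_nth_eq_sum_set:
  "distinct a \<Longrightarrow> length a = n \<Longrightarrow> (\<Sum>i<n. g (a ! i)) = (\<Sum>p\<in>set a. g p)"
  by (rule sum.reindex_bij_betw[OF bij_betw_nth]) auto

lemma energy_D_eq_point_energy:
  assumes "distinct a" "length a = n"
  shows "energy_D d w n a = point_energy d w (ennreal (2 * real (n - 1) / real n)) (set a)"
  unfolding energy_D_def point_energy_def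
  by (simp only: sum_pairs_list[OF assms, of "\<lambda>x y. K d (x - y)"] sum_nth_eq_sum_set[OF assms, of "\<lambda>x. ennreal (Q w x)"])

lemma increasing_tuplesD:
  assumes "a \<in> increasing_tuples n"
  shows "distinct a" "length a = n" "finite (set a)" "card (set a) = n"
  using assms by (auto simp: increasing_tuples_def strict_sorted_iff distinct_card)

lemma increasing_tuple_of_set:
  assumes "finite S" "card S = n"
  shows "sorted_list_of_set S \<in> increasing_tuples n" "set (sorted_list_of_set S) = S"
  using assms by (auto simp: increasing_tuples_def)

text \<open>Bolzano-Weierstrass, one coordinate after the other.\<close>

lemma bounded_sequences_common_subsequence:
  fixes x :: "nat \<Rightarrow> nat \<Rightarrow> real"
  assumes "\<And>k i. i < n \<Longrightarrow> \<bar>x k i\<bar> \<le> R"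
  shows "\<exists>r y. strict_mono (r :: nat \<Rightarrow> nat) \<and> (\<forall>i<n. (\<lambda>k. x (r k) i) \<longlonglongrightarrow> y i)"
  using assms
proof (induction n)
  case 0
  show ?case by (intro exI[of _ id]) (simp add: strict_mono_id)
next
  case (Suc n)
  then obtain r y where r: "strict_mono (r :: nat \<Rightarrow> nat)" "\<forall>i<n. (\<lambda>k. x (r k) i) \<longlonglongrightarrow> y i"
    using less_Suc_eq by metis
  have "\<forall>k. x (r k) n \<in> {-R..R}" using Suc.prems[of n] by (auto simp: abs_le_iff) (metis minus_le_iff)
  then obtain l s where s: "strict_mono (s :: nat \<Rightarrow> nat)" "((\<lambda>k. x (r k) n) \<circ> s) \<longlonglongrightarrow> l"
    using compact_Icc[of "-R" R] unfolding compact_def by (metis (no_types, lifting))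
  have "(\<lambda>k. x ((r \<circ> s) k) i) \<longlonglongrightarrow> (y(n := l)) i" if "i < Suc n" for i
  proof (cases "i = n")
    case True
    then show ?thesis using s(2) by (simp add: o_def)
  next
    case False
    then have "(\<lambda>k. x (r k) i) \<longlonglongrightarrow> y i" using r(2) that by simp
    from LIMSEQ_subseq_LIMSEQ[OF this s(1)] show ?thesis using False by (simp add: o_def)
  qed
  then show ?case using strict_mono_o[OF r(1) s(1)] by blast
qed

lemma K_finite: "x \<noteq> 0 \<Longrightarrow> K d x < \<infinity>"
  by (simp add: K_def)

lemma point_energy_finite:
  assumes "finite S" "c < \<infinity>"
  shows "point_energy d w c S < \<infinity>"
proof -
  have "(\<Sum>p\<in>S. \<Sum>q\<in>S - {p}. K d (p - q)) < \<infinity>"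
    using assms(1) by (auto simp: less_top[symmetric] intro!: K_finite[unfolded infinity_ennreal_def, THEN less_imp_neq])
  moreover have "(\<Sum>p\<in>S. ennreal (Q w p)) < \<infinity>" using assms(1) by (simp add: less_top[symmetric])
  ultimately show ?thesis unfolding point_energy_def using assms(2)
    by (simp add: ennreal_mult_less_top)
qed

lemma energy_D_tendsto:
  assumes d: "d > 0" and wf: "weight_function d w" and lim: "\<And>i. i < n \<Longrightarrow> (\<lambda>k. (a k) ! i) \<longlonglongrightarrow> b ! i"
  shows "(\<lambda>k. energy_D d w n (a k)) \<longlonglongrightarrow> energy_D d w n b"
proof -
  have "isCont (Q w) x" for x
    using Q_continuous[OF wf] by (simp add: continuous_on_eq_continuous_at)
  then show ?thesis unfolding energy_D_def
    by (intro tendsto_add ennreal_tendsto_cmult tendsto_sum)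
       (auto simp: split_beta intro!: K_tendsto[OF d] tendsto_intros lim isCont_tendsto_compose[where g="Q w"])
qed

text \<open>
  Along a subsequence the coordinates of a minimizing sequence converge, and the energies converge to
  the energy of the limit because K is continuous into [0,\<infinity>]. The limit is a weakly increasing
  tuple that attains the infimum, hence strictly increasing, because a collision costs infinite energy.
\<close>

lemma minimizer_D_exists:
  assumes d: "d > 0" and wf: "weight_function d w" and n: "n \<ge> 2"
  shows "\<exists>a\<in>increasing_tuples n. \<forall>b\<in>increasing_tuples n. energy_D d w n a \<le> energy_D d w n b"
proof -
  let ?c = "ennreal (2 * real (n - 1) / real n)"
  define A where "A = energy_D d w n ` increasing_tuples n"
  define m where "m = Inf A"
  have fin: "energy_D d w n a < \<infinity>" if "a \<in> increasing_tuples n" for a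
    using increasing_tuplesD[OF that] by (simp add: energy_D_eq_point_energy point_energy_finite[unfolded infinity_ennreal_def])
  have "sorted_list_of_set (real ` {..<n}) \<in> increasing_tuples n"
    by (rule increasing_tuple_of_set) (auto simp: card_image)
  then have A: "A \<noteq> {}" "m < \<infinity>" using fin by (auto simp: A_def m_def Inf_less_iff)
  obtain f where f: "decseq f" "range f \<subseteq> A" "m = (INF i. f i)"
    using ennreal_Inf_countable_INF[OF A(1)] unfolding m_def by blast
  have f_lim: "f \<longlonglongrightarrow> m" unfolding f(3) by (rule LIMSEQ_INF) (rule f)
  have "\<exists>b. b \<in> increasing_tuples n \<and> energy_D d w n b = f k" for k
  proof -
    have "f k \<in> A" using f(2) by blast
    then show ?thesis by (auto simp: A_def)
  qed
  then obtain a where a: "\<And>k. a k \<in> increasing_tuples n" "\<And>k. energy_D d w n (a k) = f k" by metis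
  have "f 0 < \<infinity>" using fin[OF a(1)[of 0]] a(2) by simp
  then obtain M where M: "M \<ge> 0" "f 0 = ennreal M" by (cases "f 0") auto
  obtain R where R: "\<And>x. Q w x \<le> M \<Longrightarrow> \<bar>x\<bar> \<le> R" using Q_coercive[OF d wf] by blast
  have "\<bar>(a k) ! i\<bar> \<le> R" if i: "i < n" for k i
  proof (rule R)
    have "ennreal (Q w (a k ! i)) \<le> (\<Sum>i<n. ennreal (Q w (a k ! i)))"
      using i by (intro member_le_sum) auto
    also have "\<dots> = 1 * (\<Sum>i<n. ennreal (Q w (a k ! i)))" by simp
    also have "\<dots> \<le> ?c * (\<Sum>i<n. ennreal (Q w (a k ! i)))"
    proof (rule mult_right_mono)
      have "1 \<le> 2 * real (n - 1) / real n" using n by (simp add: field_simps of_nat_diff)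
      then show "1 \<le> ?c" using ennreal_leI by fastforce
    qed simp
    also have "\<dots> \<le> energy_D d w n (a k)" unfolding energy_D_def by simp
    also have "\<dots> \<le> ennreal M" unfolding a(2) M(2)[symmetric] using f(1) by (simp add: decseqD)
    finally show "Q w (a k ! i) \<le> M" using M by simp
  qed
  from bounded_sequences_common_subsequence[where x="\<lambda>k i. a k ! i", OF this]
  obtain r y where r: "strict_mono (r :: nat \<Rightarrow> nat)" "\<And>i. i < n \<Longrightarrow> (\<lambda>k. a (r k) ! i) \<longlonglongrightarrow> y i" by blast
  define b where "b = map y [0..<n]"
  have b_lim: "(\<lambda>k. a (r k) ! i) \<longlonglongrightarrow> b ! i" if "i < n" for i using r(2)[OF that] that by (simp add: b_def)
  have "(\<lambda>k. energy_D d w n (a (r k))) \<longlonglongrightarrow> energy_D d w n b"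
    by (rule energy_D_tendsto[OF d wf b_lim])
  moreover have "(\<lambda>k. energy_D d w n (a (r k))) \<longlonglongrightarrow> m"
    unfolding a(2) using LIMSEQ_subseq_LIMSEQ[OF f_lim r(1)] by (simp add: o_def)
  ultimately have Eb: "energy_D d w n b = m" by (rule LIMSEQ_unique)
  have "b \<in> increasing_tuples n"
  proof -
    have "b ! i < b ! j" if ij: "i < j" "j < n" for i j
    proof -
      have "(a (r k)) ! i \<le> (a (r k)) ! j" for k
        using a(1)[of "r k"] ij by (auto simp: increasing_tuples_def sorted_wrt_iff_nth_less less_imp_le)
      then have "b ! i \<le> b ! j" using ij by (intro LIMSEQ_le[OF b_lim b_lim]) auto
      moreover have "b ! i \<noteq> b ! j"
      proof
        assume "b ! i = b ! j"
        then have "\<infinity> = K d (b ! i - b ! j)" by (simp add: K_def)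
        also have "\<dots> \<le> (\<Sum>(i, j) \<in> {(i, j). i < n \<and> j < n \<and> i \<noteq> j}. K d (b ! i - b ! j))"
        proof -
          have "finite {(i, j). i < n \<and> j < n \<and> i \<noteq> j}"
            by (rule finite_subset[of _ "{..<n} \<times> {..<n}"]) auto
          then show ?thesis
            using member_le_sum[of "(i, j)" "{(i, j). i < n \<and> j < n \<and> i \<noteq> j}" "\<lambda>(i, j). K d (b ! i - b ! j)"] ij
            by auto
        qed
        also have "\<dots> \<le> energy_D d w n b" unfolding energy_D_def by simp
        finally show False using Eb A(2) by (simp add: top_unique)
      qed
      ultimately show ?thesis by simp
    qed
    then show ?thesis by (auto simp: increasing_tuples_def sorted_wrt_iff_nth_less b_def)
  qed
  moreover have "m \<le> energy_D d w n c" if "c \<in> increasing_tuples n" for c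
    unfolding m_def A_def using that by (intro Inf_lower) auto
  ultimately show ?thesis using Eb by metis
qed

lemma minimizer_D_minimal:
  assumes "d > 0" "weight_function d w" "n \<ge> 2"
  shows "minimizer_D d w n \<in> increasing_tuples n"
    and "\<And>b. b \<in> increasing_tuples n \<Longrightarrow> energy_D d w n (minimizer_D d w n) \<le> energy_D d w n b"
proof -
  obtain a where a: "a \<in> increasing_tuples n" "\<And>b. b \<in> increasing_tuples n \<Longrightarrow> energy_D d w n a \<le> energy_D d w n b"
    using minimizer_D_exists[OF assms] by blast
  then have "is_arg_min (energy_D d w n) (\<lambda>a. a \<in> increasing_tuples n) a"
    by (auto simp: is_arg_min_def not_less)
  then have "is_arg_min (energy_D d w n) (\<lambda>a. a \<in> increasing_tuples n) (minimizer_D d w n)"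
    unfolding minimizer_D_def arg_min_def by (rule someI)
  then show "minimizer_D d w n \<in> increasing_tuples n"
    and "\<And>b. b \<in> increasing_tuples n \<Longrightarrow> energy_D d w n (minimizer_D d w n) \<le> energy_D d w n b"
    by (auto simp: is_arg_min_def not_less)
qed

lemma point_energy_insert:
  assumes "finite T" "x \<notin> T"
  shows "point_energy d w c (insert x T) = point_energy d w c T + (2 * (\<Sum>q\<in>T. K d (x - q)) + c * ennreal (Q w x))"
proof -
  have "(\<Sum>p\<in>insert x T. \<Sum>q\<in>insert x T - {p}. K d (p - q)) =
      (\<Sum>q\<in>T. K d (x - q)) + (\<Sum>p\<in>T. \<Sum>q\<in>insert x T - {p}. K d (p - q))"
    using assms by simp
  also have "(\<Sum>p\<in>T. \<Sum>q\<in>insert x T - {p}. K d (p - q)) = (\<Sum>p\<in>T. K d (x - p) + (\<Sum>q\<in>T - {p}. K d (p - q)))"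
  proof (rule sum.cong)
    fix p assume "p \<in> T"
    then have "insert x T - {p} = insert x (T - {p})" using assms by auto
    then show "(\<Sum>q\<in>insert x T - {p}. K d (p - q)) = K d (x - p) + (\<Sum>q\<in>T - {p}. K d (p - q))"
      using assms by (simp add: K_minus_commute[of d p x])
  qed simp
  also have "\<dots> = (\<Sum>q\<in>T. K d (x - q)) + (\<Sum>p\<in>T. \<Sum>q\<in>T - {p}. K d (p - q))"
    by (rule sum.distrib)
  finally have eq: "(\<Sum>p\<in>insert x T. \<Sum>q\<in>insert x T - {p}. K d (p - q)) =
      (\<Sum>q\<in>T. K d (x - q)) + ((\<Sum>q\<in>T. K d (x - q)) + (\<Sum>p\<in>T. \<Sum>q\<in>T - {p}. K d (p - q)))" .
  show ?thesis using assms unfolding point_energy_def eq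
    by (simp add: distrib_left mult_2 ac_simps)
qed

lemma F_D_eq:
  assumes "d > 0" "weight_function d w" "n \<ge> 2"
  defines "S \<equiv> set (minimizer_D d w n)"
  shows "F_D d w n = point_energy d w (ennreal (real (n - 1) / real n)) S"
proof -
  let ?c = "ennreal (real (n - 1) / real n)"
  note D = increasing_tuplesD[OF minimizer_D_minimal(1)[OF assms(1-3)]]
  have c: "ennreal (2 * real (n - 1) / real n) = ?c + ?c"
    by (subst ennreal_plus[symmetric]) auto
  have "?c * (\<Sum>p\<in>S. ennreal (Q w p)) \<noteq> \<top>"
    using D(3) by (simp add: S_def ennreal_mult_eq_top_iff)
  then have "point_energy d w (?c + ?c) S - ?c * (\<Sum>p\<in>S. ennreal (Q w p)) = point_energy d w ?c S"
    unfolding point_energy_def distrib_right add.assoc[symmetric] by (rule ennreal_add_diff_cancel_right)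
  then show ?thesis
    unfolding F_D_def energy_D_eq_point_energy[OF D(1,2)] sum_nth_eq_sum_set[OF D(1,2), of "\<lambda>x. ennreal (Q w x)"]
    unfolding c S_def .
qed

text \<open>
  Replacing a point p by x changes the energy only through the terms that involve p, so minimality
  says that p, in the field of the other points, is not worse than x. In the sum over all p each
  point q is met once for every p \<noteq> q, which is the origin of the factor n - 1. For x in S the
  right-hand side is infinite.
\<close>

lemma F_D_le_potential:
  assumes d: "d > 0" and wf: "weight_function d w" and n: "n \<ge> 2"
  defines "S \<equiv> set (minimizer_D d w n)"
  shows "F_D d w n \<le> of_nat (n - 1) * ((\<Sum>q\<in>S. K d (x - q)) + ennreal (Q w x))"
proof -
  let ?c = "ennreal (real (n - 1) / real n)"
  note min = minimizer_D_minimal[OF d wf n]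
  note D = increasing_tuplesD[OF min(1)]
  have fS: "finite S" "card S = n" using D by (auto simp: S_def)
  have c2: "ennreal (2 * real (n - 1) / real n) = 2 * ?c"
    unfolding mult_2 by (subst ennreal_plus[symmetric]) auto
  show ?thesis
  proof (cases "x \<in> S")
    case True
    have "\<infinity> = K d (x - x)" by (simp add: K_def)
    also have "\<dots> \<le> (\<Sum>q\<in>S. K d (x - q))" by (rule member_le_sum[of x S "\<lambda>q. K d (x - q)"]) (use True fS in auto)
    finally have "(\<Sum>q\<in>S. K d (x - q)) = \<top>" by (simp add: top_unique)
    then show ?thesis using n by (simp add: ennreal_mult_top)
  next
    case False
    have point: "(\<Sum>q\<in>S - {p}. K d (p - q)) + ?c * ennreal (Q w p) \<le> (\<Sum>q\<in>S - {p}. K d (x - q)) + ?c * ennreal (Q w x)"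
      if p: "p \<in> S" for p
    proof -
      let ?T = "S - {p}"
      let ?E = "point_energy d w (2 * ?c)"
      have S: "S = insert p ?T" using p by auto
      have T: "finite ?T" "card (insert x ?T) = n" using fS p False n by auto
      have e1: "?E S \<le> ?E (insert x ?T)"
      proof -
        have fin: "finite (insert x ?T)" using T by simp
        note tup = increasing_tuple_of_set[OF fin T(2)]
        note E' = energy_D_eq_point_energy[OF increasing_tuplesD(1,2)[OF tup(1)]]
        show ?thesis
          using min(2)[OF tup(1)] unfolding E' energy_D_eq_point_energy[OF D(1,2)] tup(2) c2 S_def[symmetric] .
      qed
      have "?E (insert p ?T) = ?E ?T + (2 * (\<Sum>q\<in>?T. K d (p - q)) + 2 * ?c * ennreal (Q w p))"
        by (rule point_energy_insert) (use T in auto)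
      then have e2: "?E S = ?E ?T + (2 * (\<Sum>q\<in>?T. K d (p - q)) + 2 * ?c * ennreal (Q w p))"
        unfolding S[symmetric] .
      have e3: "?E (insert x ?T) = ?E ?T + (2 * (\<Sum>q\<in>?T. K d (x - q)) + 2 * ?c * ennreal (Q w x))"
        by (rule point_energy_insert) (use T False in auto)
      have "?E ?T \<noteq> \<top>" using point_energy_finite[OF T(1), of "2 * ?c" d w] by (simp add: ennreal_mult_less_top less_top)
      with e1 have "2 * (\<Sum>q\<in>?T. K d (p - q)) + 2 * ?c * ennreal (Q w p) \<le> 2 * (\<Sum>q\<in>?T. K d (x - q)) + 2 * ?c * ennreal (Q w x)"
        unfolding e2 e3 by (simp only: ennreal_add_left_cancel_le infinity_ennreal_def) simp
      then have "2 * ((\<Sum>q\<in>?T. K d (p - q)) + ?c * ennreal (Q w p)) \<le> 2 * ((\<Sum>q\<in>?T. K d (x - q)) + ?c * ennreal (Q w x))"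
        by (simp only: distrib_left mult.assoc)
      then show ?thesis by (subst (asm) ennreal_mult_le_mult_iff) auto
    qed
    have "F_D d w n = (\<Sum>p\<in>S. (\<Sum>q\<in>S - {p}. K d (p - q)) + ?c * ennreal (Q w p))"
      unfolding F_D_eq[OF d wf n] point_energy_def S_def by (simp add: sum.distrib sum_distrib_left)
    also have "\<dots> \<le> (\<Sum>p\<in>S. (\<Sum>q\<in>S - {p}. K d (x - q)) + ?c * ennreal (Q w x))"
      by (rule sum_mono) (rule point)
    also have "\<dots> = (\<Sum>p\<in>S. \<Sum>q\<in>S - {p}. K d (x - q)) + (\<Sum>p\<in>S. ?c * ennreal (Q w x))"
      by (rule sum.distrib)
    also have "(\<Sum>p\<in>S. \<Sum>q\<in>S - {p}. K d (x - q)) = (\<Sum>p\<in>S. \<Sum>q\<in>{q\<in>S. p \<noteq> q}. K d (x - q))"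
      by (intro sum.cong) auto
    also have "\<dots> = (\<Sum>q\<in>S. \<Sum>p\<in>{p\<in>S. p \<noteq> q}. K d (x - q))"
      by (rule sum.swap_restrict) (use fS in auto)
    also have "\<dots> = (\<Sum>q\<in>S. of_nat (n - 1) * K d (x - q))"
    proof (rule sum.cong)
      fix q assume "q \<in> S"
      have "{p\<in>S. p \<noteq> q} = S - {q}" by auto
      then show "(\<Sum>p\<in>{p\<in>S. p \<noteq> q}. K d (x - q)) = of_nat (n - 1) * K d (x - q)" using \<open>q \<in> S\<close> fS by simp
    qed simp
    also have "(\<Sum>p\<in>S. ?c * ennreal (Q w x)) = of_nat (n - 1) * ennreal (Q w x)"
    proof -
      have "of_nat n * ?c = ennreal (real n * (real (n - 1) / real n))"
        unfolding ennreal_of_nat_eq_real_of_nat by (rule ennreal_mult[symmetric]) simp_all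
      also have "\<dots> = of_nat (n - 1)" using n by (simp add: ennreal_of_nat_eq_real_of_nat)
      finally show ?thesis using fS by (simp add: mult.assoc[symmetric])
    qed
    finally show ?thesis by (simp add: sum_distrib_left distrib_left)
  qed
qed

section \<open>Spreading points over the gaps between them\<close>

lemma nn_integral_interval_eq_U01:
  assumes [measurable]: "f \<in> borel_measurable borel" and c: "c \<noteq> 0"
    and ind: "\<And>u. a + c * u \<in> I \<longleftrightarrow> u \<in> {0<..<1}" and [measurable]: "I \<in> sets borel"
  shows "(\<integral>\<^sup>+x\<in>I. f x \<partial>lborel) = ennreal \<bar>c\<bar> * (\<integral>\<^sup>+u. f (a + c * u) \<partial>U01)"
proof -
  have "(\<integral>\<^sup>+x\<in>I. f x \<partial>lborel) = ennreal \<bar>c\<bar> * (\<integral>\<^sup>+u. f (a + c * u) * indicator I (a + c * u) \<partial>lborel)"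
    by (rule nn_integral_real_affine[OF _ c]) measurable
  also have "(\<lambda>u. f (a + c * u) * indicator I (a + c * u)) = (\<lambda>u. f (a + c * u) * indicator {0<..<1} u)"
    using ind by (intro ext) (simp add: indicator_def)
  also have "(\<integral>\<^sup>+u. f (a + c * u) * indicator {0<..<1} u \<partial>lborel) = (\<integral>\<^sup>+u. f (a + c * u) \<partial>U01)"
    by (rule nn_integral_U01[symmetric]) measurable
  finally show ?thesis .
qed

lemma nn_integral_U01_reflect:
  assumes [measurable]: "f \<in> borel_measurable borel"
  shows "(\<integral>\<^sup>+u. f (1 - u) \<partial>U01) = (\<integral>\<^sup>+u. f u \<partial>U01)"
proof -
  have "(\<integral>\<^sup>+x\<in>{0<..<1}. f x \<partial>lborel) = ennreal \<bar>-1\<bar> * (\<integral>\<^sup>+u. f (1 + (-1) * u) \<partial>U01)"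
    by (rule nn_integral_interval_eq_U01) auto
  then show ?thesis by (simp add: nn_integral_U01)
qed

text \<open>The inequality ln u \<le> u - 1 at u = 1/(2t) and at u = 1/(2(1-t)).\<close>

lemma binary_entropy_le_ln2:
  assumes "0 < t" "t < (1::real)"
  shows "t * (- ln t) + (1 - t) * (- ln (1 - t)) \<le> ln 2"
proof -
  have *: "t * (- ln t) \<le> t * ln 2 + (1 / 2 - t)" if t: "0 < t" for t :: real
  proof -
    have "ln (1 / (2 * t)) \<le> 1 / (2 * t) - 1" by (rule ln_le_minus_one) (use t in auto)
    then have "t * ln (1 / (2 * t)) \<le> t * (1 / (2 * t) - 1)" using t by (intro mult_left_mono) auto
    moreover have "ln (1 / (2 * t)) = - ln 2 - ln t" using t by (simp add: ln_div ln_mult)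
    moreover have "t * (1 / (2 * t) - 1) = 1 / 2 - t" using t by (simp add: field_simps)
    ultimately have "t * (- ln 2 - ln t) \<le> 1 / 2 - t" by simp
    then show ?thesis by (simp add: algebra_simps)
  qed
  show ?thesis using *[of t] *[of "1 - t"] assms by (simp add: algebra_simps)
qed

text \<open>
  The point t cuts the interval into pieces of relative lengths t and 1 - t. On a piece of length
  \<tau> h the average of K is at most K(\<tau> h) + 1 \<le> K(h) - ln \<tau> + 1, and weighting the two pieces by their
  lengths turns the logarithms into the binary entropy of t.
\<close>

lemma K_interval_potential_le:
  assumes d: "d > 0" and h: "h > 0" and t: "0 < t" "t < 1"
  shows "(\<integral>\<^sup>+s. K d ((s - t) * h) \<partial>U01) \<le> K d h + ennreal (1 + ln 2)"
proof -
  have part: "ennreal \<tau> * (\<integral>\<^sup>+u. K d (u * (\<tau> * h)) \<partial>U01) \<le> ennreal \<tau> * (K d h + ennreal (1 - ln \<tau>))"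
    if "0 < \<tau>" "\<tau> < 1" for \<tau>
  proof (rule mult_left_mono)
    have "(\<integral>\<^sup>+u. K d (u * (\<tau> * h)) \<partial>U01) \<le> K d (\<tau> * h) + 1"
      using that h by (intro K_average_le d) auto
    also have "\<dots> \<le> (K d h + ennreal (- ln \<tau>)) + 1"
      using that h by (intro add_mono K_scaled_le d) auto
    also have "\<dots> = K d h + ennreal (1 - ln \<tau>)"
    proof -
      have "- ln \<tau> \<ge> 0" using that by (simp add: ln_le_zero_iff)
      then have "ennreal (1 + - ln \<tau>) = 1 + ennreal (- ln \<tau>)" by (subst ennreal_plus) auto
      then show ?thesis by (simp add: ac_simps)
    qed
    finally show "(\<integral>\<^sup>+u. K d (u * (\<tau> * h)) \<partial>U01) \<le> K d h + ennreal (1 - ln \<tau>)" .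
  qed simp
  have "(\<integral>\<^sup>+s. K d ((s - t) * h) \<partial>U01) = (\<integral>\<^sup>+s\<in>{0<..<1}. K d ((s - t) * h) \<partial>lborel)"
    by (rule nn_integral_U01) measurable
  also have "\<dots> = (\<integral>\<^sup>+s. K d ((s - t) * h) * indicator {0<..<t} s + K d ((s - t) * h) * indicator {t<..<1} s \<partial>lborel)"
  proof (rule nn_integral_cong_AE)
    have "AE s in lborel. s \<noteq> t" by (rule AE_lborel_singleton)
    then show "AE s in lborel. K d ((s - t) * h) * indicator {0<..<1} s =
        K d ((s - t) * h) * indicator {0<..<t} s + K d ((s - t) * h) * indicator {t<..<1} s"
      by eventually_elim (use t in \<open>auto simp: indicator_def\<close>)
  qed
  also have "\<dots> = (\<integral>\<^sup>+s\<in>{0<..<t}. K d ((s - t) * h) \<partial>lborel) + (\<integral>\<^sup>+s\<in>{t<..<1}. K d ((s - t) * h) \<partial>lborel)"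
    by (rule nn_integral_add) measurable
  also have "(\<integral>\<^sup>+s\<in>{0<..<t}. K d ((s - t) * h) \<partial>lborel) = ennreal \<bar>- t\<bar> * (\<integral>\<^sup>+u. K d ((t + (- t) * u - t) * h) \<partial>U01)"
    by (rule nn_integral_interval_eq_U01) (use t in \<open>auto simp: mult_less_cancel_left1 zero_less_mult_iff\<close>)
  also have "\<dots> = ennreal t * (\<integral>\<^sup>+u. K d (u * (t * h)) \<partial>U01)"
  proof -
    have "K d ((t + (- t) * u - t) * h) = K d (u * (t * h))" for u
      using K_even[of d "u * (t * h)"] by (simp add: mult_ac)
    then show ?thesis using t by simp
  qed
  also have "(\<integral>\<^sup>+s\<in>{t<..<1}. K d ((s - t) * h) \<partial>lborel) = ennreal \<bar>1 - t\<bar> * (\<integral>\<^sup>+u. K d ((t + (1 - t) * u - t) * h) \<partial>U01)"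
  proof (rule nn_integral_interval_eq_U01)
    fix u
    have "t + (1 - t) * u < 1 \<longleftrightarrow> (1 - t) * u < (1 - t) * 1" by auto
    also have "\<dots> \<longleftrightarrow> u < 1" using t by (subst mult_less_cancel_left_pos) auto
    finally show "t + (1 - t) * u \<in> {t<..<1} \<longleftrightarrow> u \<in> {0<..<1}" using t by (auto simp: zero_less_mult_iff)
  qed (use t in auto)
  also have "\<dots> = ennreal (1 - t) * (\<integral>\<^sup>+u. K d (u * ((1 - t) * h)) \<partial>U01)"
    using t by (simp add: mult_ac)
  also have "ennreal t * (\<integral>\<^sup>+u. K d (u * (t * h)) \<partial>U01) + ennreal (1 - t) * (\<integral>\<^sup>+u. K d (u * ((1 - t) * h)) \<partial>U01)
     \<le> ennreal t * (K d h + ennreal (1 - ln t)) + ennreal (1 - t) * (K d h + ennreal (1 - ln (1 - t)))"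
    using t by (intro add_mono part) auto
  also have "\<dots> = (ennreal t + ennreal (1 - t)) * K d h + (ennreal t * ennreal (1 - ln t) + ennreal (1 - t) * ennreal (1 - ln (1 - t)))"
    by (simp only: distrib_left distrib_right ac_simps)
  also have "ennreal t + ennreal (1 - t) = 1" using t by (subst ennreal_plus[symmetric]) auto
  also have "ennreal t * ennreal (1 - ln t) + ennreal (1 - t) * ennreal (1 - ln (1 - t)) = ennreal (t * (1 - ln t) + (1 - t) * (1 - ln (1 - t)))"
    using t by (intro ennreal_lin_comb) (auto simp: ln_le_zero_iff intro: order_trans[of _ 0])
  also have "t * (1 - ln t) + (1 - t) * (1 - ln (1 - t)) = 1 + (t * (- ln t) + (1 - t) * (- ln (1 - t)))"
    by (simp add: algebra_simps)
  also have "1 * K d h + ennreal \<dots> \<le> K d h + ennreal (1 + ln 2)"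
    using binary_entropy_le_ln2[OF t] by (simp only: mult_1) (intro add_left_mono ennreal_leI, simp)
  finally show ?thesis .
qed

text \<open>
  With H = h + h', the distance s h + t h' is a convex combination of s H and t H, so convexity of K
  separates the two variables.
\<close>

lemma K_adjacent_intervals_le:
  assumes d: "d > 0" and h: "h > 0" "h' > 0"
  shows "(\<integral>\<^sup>+s. \<integral>\<^sup>+t. K d (s * h + t * h') \<partial>U01 \<partial>U01) \<le> K d (h + h') + 1"
proof -
  interpret U: prob_space U01 by (rule prob_space_U01)
  define H where "H = h + h'"
  define l where "l = h' / H"
  have H: "H > 0" using h by (simp add: H_def)
  have l: "0 \<le> l" "l \<le> 1" using h H by (auto simp: l_def H_def)
  have e: "l * H = h'" "(1 - l) * H = h" using H by (simp_all add: l_def H_def field_simps)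
  have "(\<integral>\<^sup>+s. \<integral>\<^sup>+t. K d (s * h + t * h') \<partial>U01 \<partial>U01) \<le>
      (\<integral>\<^sup>+s. \<integral>\<^sup>+t. ennreal (1 - l) * K d (s * H) + ennreal l * K d (t * H) \<partial>U01 \<partial>U01)"
  proof (rule nn_integral_mono_AE)
    show "AE s in U01. (\<integral>\<^sup>+t. K d (s * h + t * h') \<partial>U01) \<le> (\<integral>\<^sup>+t. ennreal (1 - l) * K d (s * H) + ennreal l * K d (t * H) \<partial>U01)"
      using AE_U01
    proof eventually_elim
      case (elim s)
      show ?case
      proof (rule nn_integral_mono_AE)
        show "AE t in U01. K d (s * h + t * h') \<le> ennreal (1 - l) * K d (s * H) + ennreal l * K d (t * H)"
          using AE_U01
        proof eventually_elim
          case (elim t)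
          have "s * h + t * h' = (1 - l) * (s * H) + l * (t * H)"
            using e by (simp add: mult.left_commute)
          then show ?case using K_convex[OF d _ _ l, of "s * H" "t * H"] elim \<open>0 < s \<and> s < 1\<close> H by simp
        qed
      qed
    qed
  qed
  also have "\<dots> = (\<integral>\<^sup>+s. ennreal (1 - l) * K d (s * H) + ennreal l * (\<integral>\<^sup>+t. K d (t * H) \<partial>U01) \<partial>U01)"
    by (simp add: nn_integral_add nn_integral_cmult U.emeasure_space_1)
  also have "\<dots> = ennreal (1 - l) * (\<integral>\<^sup>+s. K d (s * H) \<partial>U01) + ennreal l * (\<integral>\<^sup>+t. K d (t * H) \<partial>U01)"
    by (simp add: nn_integral_add nn_integral_cmult U.emeasure_space_1)
  also have "\<dots> \<le> ennreal (1 - l) * (K d H + 1) + ennreal l * (K d H + 1)"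
    by (intro add_mono mult_left_mono K_average_le d H) auto
  also have "\<dots> = K d H + 1"
    using l by (simp add: distrib_right[symmetric] ennreal_plus[symmetric] del: ennreal_plus)
  finally show ?thesis unfolding H_def .
qed

definition smear :: "(nat \<Rightarrow> real) \<Rightarrow> nat \<Rightarrow> real \<Rightarrow> real" where
  "smear a i s = a i + s * (a (Suc i) - a i)"

definition gap_energy :: "real \<Rightarrow> (nat \<Rightarrow> real) \<Rightarrow> nat \<Rightarrow> nat \<Rightarrow> ennreal" where
  "gap_energy d a i j = (\<integral>\<^sup>+s. \<integral>\<^sup>+t. K d (smear a i s - smear a j t) \<partial>U01 \<partial>U01)"

lemma smear_measurable [measurable]: "smear a i \<in> borel_measurable borel"
  unfolding smear_def[abs_def] by measurable

text \<open>A gap is chosen uniformly, and then a point of that gap uniformly.\<close>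

lemma smeared_measure_exists:
  assumes m: "m > 0"
  shows "\<exists>N. real_distribution N \<and> (\<forall>f. f \<in> borel_measurable borel \<longrightarrow>
    (\<integral>\<^sup>+x. f x \<partial>N) = (\<Sum>i<m. \<integral>\<^sup>+s. f (smear a i s) \<partial>U01) / of_nat m)"
proof -
  interpret U: prob_space U01 by (rule prob_space_U01)
  let ?p = "pmf_of_set {..<m}"
  let ?D = "\<lambda>i. distr U01 borel (smear a i)"
  have D: "?D \<in> measurable (measure_pmf ?p) (subprob_algebra borel)"
    by (auto simp: space_subprob_algebra intro!: prob_space_imp_subprob_space U.prob_space_distr)
  have int: "(\<integral>\<^sup>+x. f x \<partial>(measure_pmf ?p \<bind> ?D)) = (\<Sum>i<m. \<integral>\<^sup>+s. f (smear a i s) \<partial>U01) / of_nat m"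
    if [measurable]: "f \<in> borel_measurable borel" for f
  proof -
    have "(\<integral>\<^sup>+x. f x \<partial>(measure_pmf ?p \<bind> ?D)) = (\<Sum>i<m. \<integral>\<^sup>+x. f x \<partial>?D i) / of_nat m"
      using m by (subst nn_integral_bind[OF that D], subst nn_integral_pmf_of_set)
         (auto simp: lessThan_empty_iff)
    then show ?thesis by (simp add: nn_integral_distr)
  qed
  have sets: "sets (measure_pmf ?p \<bind> ?D) = sets borel"
    by (rule sets_bind[OF sets_kernel[OF D]]) auto
  have "emeasure (measure_pmf ?p \<bind> ?D) (space (measure_pmf ?p \<bind> ?D)) = (\<integral>\<^sup>+x. 1 \<partial>(measure_pmf ?p \<bind> ?D))"
    by simp
  also have "\<dots> = of_nat m / of_nat m"
    by (subst int) (simp_all add: U.emeasure_space_1[simplified])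
  also have "\<dots> = 1" using m by (intro ennreal_divide_self) (auto simp: less_top[symmetric])
  finally have "prob_space (measure_pmf ?p \<bind> ?D)" by (rule prob_spaceI)
  then show ?thesis using sets int by (blast intro: real_distributionI)
qed

lemma mutual_energy_smeared:
  assumes N: "real_distribution N" and int: "\<And>f. f \<in> borel_measurable borel \<Longrightarrow>
    (\<integral>\<^sup>+x. f x \<partial>N) = (\<Sum>i<m. \<integral>\<^sup>+s. f (smear a i s) \<partial>U01) / of_nat m"
  shows "mutual_energy d N N = (\<Sum>i<m. \<Sum>j<m. gap_energy d a i j) / of_nat m / of_nat m"
proof -
  interpret N: real_distribution N by fact
  interpret U: prob_space U01 by (rule prob_space_U01)
  note [measurable] = potential_measurable[OF N]
  have pot: "potential d N x = (\<Sum>j<m. \<integral>\<^sup>+t. K d (x - smear a j t) \<partial>U01) / of_nat m" for x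
    unfolding potential_def by (rule int) measurable
  have inner: "(\<integral>\<^sup>+s. potential d N (smear a i s) \<partial>U01) = (\<Sum>j<m. gap_energy d a i j) / of_nat m" for i
    unfolding pot gap_energy_def
    by (subst nn_integral_divide) (auto intro!: arg_cong2[where f="(/)"] nn_integral_sum)
  have "mutual_energy d N N = (\<Sum>i<m. \<integral>\<^sup>+s. potential d N (smear a i s) \<partial>U01) / of_nat m"
    unfolding mutual_energy_def by (rule int) measurable
  then show ?thesis unfolding inner by (simp add: divide_ennreal_def sum_distrib_right)
qed

lemma gap_energy_commute: "gap_energy d a i j = gap_energy d a j i"
proof -
  interpret U: prob_space U01 by (rule prob_space_U01)
  interpret pair_sigma_finite U01 U01 by standard
  show ?thesis unfolding gap_energy_def
    by (subst Fubini') (simp_all add: K_minus_commute)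
qed

lemma gap_energy_self_le:
  assumes d: "d > 0" and a: "a i < a (Suc i)"
  shows "gap_energy d a i i \<le> K d (a (Suc i) - a i) + ennreal (1 + ln 2)"
proof -
  interpret U: prob_space U01 by (rule prob_space_U01)
  let ?h = "a (Suc i) - a i"
  have "gap_energy d a i i \<le> (\<integral>\<^sup>+s. K d ?h + ennreal (1 + ln 2) \<partial>U01)"
    unfolding gap_energy_def
  proof (rule nn_integral_mono_AE)
    show "AE s in U01. (\<integral>\<^sup>+t. K d (smear a i s - smear a i t) \<partial>U01) \<le> K d ?h + ennreal (1 + ln 2)"
      using AE_U01
    proof eventually_elim
      case (elim s)
      have "K d (smear a i s - smear a i t) = K d ((t - s) * ?h)" for t
        using K_even[of d "(t - s) * ?h"] by (simp add: smear_def algebra_simps)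
      then show ?case using K_interval_potential_le[OF d, of ?h s] a elim by simp
    qed
  qed
  then show ?thesis by (simp add: U.emeasure_space_1[simplified])
qed

text \<open>
  The parameter of the left gap is reversed, so that both distances are measured from the common endpoint.
\<close>

lemma gap_energy_adjacent_le:
  assumes d: "d > 0" and a: "a i < a (Suc i)" "a (Suc i) < a (Suc (Suc i))"
  shows "gap_energy d a i (Suc i) \<le> K d (a (Suc (Suc i)) - a i) + 1"
proof -
  interpret U: prob_space U01 by (rule prob_space_U01)
  let ?h = "a (Suc i) - a i" and ?h' = "a (Suc (Suc i)) - a (Suc i)"
  have "K d (smear a i s - smear a (Suc i) t) = K d ((1 - s) * ?h + t * ?h')" for s t
    using K_even[of d "(1 - s) * ?h + t * ?h'"] by (simp add: smear_def algebra_simps)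
  then have "gap_energy d a i (Suc i) = (\<integral>\<^sup>+s. \<integral>\<^sup>+t. K d ((1 - s) * ?h + t * ?h') \<partial>U01 \<partial>U01)"
    by (simp add: gap_energy_def)
  also have "\<dots> = (\<integral>\<^sup>+s. \<integral>\<^sup>+t. K d (s * ?h + t * ?h') \<partial>U01 \<partial>U01)"
    by (rule nn_integral_U01_reflect[of "\<lambda>s. \<integral>\<^sup>+t. K d (s * ?h + t * ?h') \<partial>U01"]) measurable
  also have "\<dots> \<le> K d (?h + ?h') + 1"
    using a by (intro K_adjacent_intervals_le d) auto
  finally show ?thesis by simp
qed

lemma gap_energy_separated_le:
  assumes d: "d > 0" and a: "a i \<le> a (Suc i)" "a (Suc i) \<le> a j" "a j \<le> a (Suc j)"
  shows "gap_energy d a i j \<le> K d (a j - a (Suc i))"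
proof -
  interpret U: prob_space U01 by (rule prob_space_U01)
  have "gap_energy d a i j \<le> (\<integral>\<^sup>+s. \<integral>\<^sup>+t. K d (a j - a (Suc i)) \<partial>U01 \<partial>U01)"
    unfolding gap_energy_def
  proof (rule nn_integral_mono_AE)
    show "AE s in U01. (\<integral>\<^sup>+t. K d (smear a i s - smear a j t) \<partial>U01) \<le> (\<integral>\<^sup>+t. K d (a j - a (Suc i)) \<partial>U01)"
      using AE_U01
    proof eventually_elim
      case (elim s)
      have s: "smear a i s \<le> a (Suc i)"
        using mult_left_le_one_le[of "a (Suc i) - a i" s] elim a by (simp add: smear_def)
      show ?case
      proof (rule nn_integral_mono_AE)
        show "AE t in U01. K d (smear a i s - smear a j t) \<le> K d (a j - a (Suc i))"
          using AE_U01
        proof eventually_elim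
          case (elim t)
          have "a j \<le> smear a j t" using elim a by (simp add: smear_def)
          then show ?case using s a by (intro K_antimono_abs d) auto
        qed
      qed
    qed
  qed
  then show ?thesis by (simp add: U.emeasure_space_1[simplified])
qed

section \<open>Comparison of the two minimal energies\<close>

lemma sum_offdiag_symmetric:
  fixes g :: "nat \<Rightarrow> nat \<Rightarrow> ennreal"
  assumes "\<And>i j. g i j = g j i"
  shows "(\<Sum>(i, j)\<in>{(i, j). i < n \<and> j < n \<and> i \<noteq> j}. g i j) = 2 * (\<Sum>(i, j)\<in>{(i, j). i < j \<and> j < n}. g i j)"
proof -
  let ?U = "{(i, j). i < j \<and> j < n}" and ?L = "{(i, j). j < i \<and> i < n}"
  have fin: "finite ?U" "finite ?L" by (rule finite_subset[of _ "{..<n} \<times> {..<n}"]; force)+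
  have "{(i, j). i < n \<and> j < n \<and> i \<noteq> j} = ?U \<union> ?L" by auto
  then have "(\<Sum>(i, j)\<in>{(i, j). i < n \<and> j < n \<and> i \<noteq> j}. g i j) = (\<Sum>(i, j)\<in>?U. g i j) + (\<Sum>(i, j)\<in>?L. g i j)"
    using fin by (simp add: sum.union_disjoint disjoint_iff)
  also have "(\<Sum>(i, j)\<in>?L. g i j) = (\<Sum>(i, j)\<in>?U. g i j)"
    by (rule sum.reindex_bij_witness[of _ prod.swap prod.swap]) (use assms in auto)
  finally show ?thesis by (simp add: mult_2)
qed

lemma sum_square_split_diagonal:
  fixes g :: "nat \<Rightarrow> nat \<Rightarrow> ennreal"
  shows "(\<Sum>i<m. \<Sum>j<m. g i j) = (\<Sum>i<m. g i i) + (\<Sum>(i, j)\<in>{(i, j). i < m \<and> j < m \<and> i \<noteq> j}. g i j)"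
proof -
  have "{(i, j). i < m \<and> j < m \<and> i \<noteq> j} = Sigma {..<m} (\<lambda>i. {..<m} - {i})" by auto
  then have "(\<Sum>(i, j)\<in>{(i, j). i < m \<and> j < m \<and> i \<noteq> j}. g i j) = (\<Sum>i<m. \<Sum>j\<in>{..<m} - {i}. g i j)"
    by (simp add: sum.Sigma)
  moreover have "(\<Sum>j<m. g i j) = g i i + (\<Sum>j\<in>{..<m} - {i}. g i j)" if "i < m" for i
    using that by (intro sum.remove) auto
  ultimately show ?thesis by (simp add: sum.distrib)
qed

text \<open>
  Let T be the sum of K over unordered pairs of points, D1 its part over neighbours and D2 its part
  over second neighbours. The diagonal terms use D1 and cost 1 + ln 2 per gap; the adjacent gaps, in
  both orders, use 2 D2 and cost at most 2 per gap; the separated gaps, in both orders, use at most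
  2 T. Since D1 + D2 \<le> T, the total is at most 4 T, and 2 T is the sum over ordered pairs.
\<close>

lemma gap_energy_sum_le:
  assumes d: "d > 0" and m: "m > 0" and a: "\<And>i j. i < j \<Longrightarrow> j \<le> m \<Longrightarrow> a i < a j"
  shows "(\<Sum>i<m. \<Sum>j<m. gap_energy d a i j) \<le>
    2 * (\<Sum>(i, j)\<in>{(i, j). i < Suc m \<and> j < Suc m \<and> i \<noteq> j}. K d (a i - a j)) + of_nat m * ennreal (3 + ln 2)"
proof -
  let ?k = "\<lambda>(i, j). K d (a i - a j)"
  let ?g = "\<lambda>(i, j). gap_energy d a i j"
  define P where "P = {(i, j). i < j \<and> j < Suc m}"
  define T where "T = sum ?k P"
  define D1 where "D1 = (\<Sum>i<m. K d (a i - a (Suc i)))"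
  define D2 where "D2 = (\<Sum>i<m - 1. K d (a i - a (Suc (Suc i))))"
  have finP: "finite P" unfolding P_def by (rule finite_subset[of _ "{..<Suc m} \<times> {..<Suc m}"]) auto
  have D12: "D1 + D2 \<le> T"
  proof -
    let ?A = "(\<lambda>i. (i, Suc i)) ` {..<m}" and ?B = "(\<lambda>i. (i, Suc (Suc i))) ` {..<m - 1}"
    have "D1 = sum ?k ?A" unfolding D1_def by (subst sum.reindex) (auto simp: inj_on_def)
    moreover have "D2 = sum ?k ?B" unfolding D2_def by (subst sum.reindex) (auto simp: inj_on_def)
    ultimately have "D1 + D2 = sum ?k (?A \<union> ?B)" by (subst sum.union_disjoint) auto
    also have "\<dots> \<le> T" unfolding T_def by (rule sum_mono2[OF finP]) (auto simp: P_def)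
    finally show ?thesis .
  qed
  have diag: "(\<Sum>i<m. gap_energy d a i i) \<le> D1 + of_nat m * ennreal (1 + ln 2)"
  proof -
    have "(\<Sum>i<m. gap_energy d a i i) \<le> (\<Sum>i<m. K d (a i - a (Suc i)) + ennreal (1 + ln 2))"
    proof (rule sum_mono)
      fix i assume "i \<in> {..<m}"
      then show "gap_energy d a i i \<le> K d (a i - a (Suc i)) + ennreal (1 + ln 2)"
        using gap_energy_self_le[OF d, of a i] a[of i "Suc i"] by (simp add: K_minus_commute[of d "a i"])
    qed
    then show ?thesis by (simp only: sum.distrib D1_def sum_constant card_lessThan)
  qed
  have near: "(\<Sum>i<m - 1. gap_energy d a i (Suc i)) \<le> D2 + of_nat m"
  proof -
    have "(\<Sum>i<m - 1. gap_energy d a i (Suc i)) \<le> (\<Sum>i<m - 1. K d (a i - a (Suc (Suc i))) + 1)"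
    proof (rule sum_mono)
      fix i assume "i \<in> {..<m - 1}"
      then show "gap_energy d a i (Suc i) \<le> K d (a i - a (Suc (Suc i))) + 1"
        using gap_energy_adjacent_le[OF d, of a i] a[of i "Suc i"] a[of "Suc i" "Suc (Suc i)"]
        by (simp add: K_minus_commute[of d "a i"])
    qed
    also have "\<dots> = D2 + of_nat (m - 1)" by (simp add: sum.distrib D2_def)
    also have "\<dots> \<le> D2 + of_nat m" by (intro add_left_mono of_nat_mono) simp
    finally show ?thesis .
  qed
  have far: "sum ?g {(i, j). Suc i < j \<and> j < m} \<le> T"
  proof -
    let ?F = "{(i, j). Suc i < j \<and> j < m}"
    have "sum ?g ?F \<le> (\<Sum>p\<in>?F. ?k ((\<lambda>(i, j). (Suc i, j)) p))"
    proof (rule sum_mono)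
      fix p assume "p \<in> ?F"
      then obtain i j where p: "p = (i, j)" "Suc i < j" "j < m" by auto
      then show "?g p \<le> ?k ((\<lambda>(i, j). (Suc i, j)) p)"
        using gap_energy_separated_le[OF d, of a i j] a[of i "Suc i"] a[of "Suc i" j] a[of j "Suc j"]
        by (simp add: K_minus_commute[of d "a (Suc i)"])
    qed
    also have "\<dots> = sum ?k ((\<lambda>(i, j). (Suc i, j)) ` ?F)"
      by (subst sum.reindex) (auto simp: inj_on_def)
    also have "\<dots> \<le> T" unfolding T_def by (rule sum_mono2[OF finP]) (auto simp: P_def)
    finally show ?thesis .
  qed
  have "sum ?g {(i, j). i < j \<and> j < m} = (\<Sum>i<m - 1. gap_energy d a i (Suc i)) + sum ?g {(i, j). Suc i < j \<and> j < m}"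
  proof -
    let ?A = "(\<lambda>i. (i, Suc i)) ` {..<m - 1}"
    have "{(i, j). i < j \<and> j < m} = ?A \<union> {(i, j). Suc i < j \<and> j < m}"
      by (auto simp: image_iff)
    moreover have "finite {(i, j). Suc i < j \<and> j < m}" by (rule finite_subset[of _ "{..<m} \<times> {..<m}"]) auto
    ultimately have "sum ?g {(i, j). i < j \<and> j < m} = sum ?g ?A + sum ?g {(i, j). Suc i < j \<and> j < m}"
      by (simp only:) (subst sum.union_disjoint, auto)
    moreover have "sum ?g ?A = (\<Sum>i<m - 1. gap_energy d a i (Suc i))"
      by (subst sum.reindex) (auto simp: inj_on_def)
    ultimately show ?thesis by simp
  qed
  also have "\<dots> \<le> (D2 + of_nat m) + T" by (intro add_mono near far)
  finally have off: "sum ?g {(i, j). i < j \<and> j < m} \<le> (D2 + of_nat m) + T" .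
  have "(\<Sum>i<m. \<Sum>j<m. gap_energy d a i j) = (\<Sum>i<m. gap_energy d a i i) + 2 * sum ?g {(i, j). i < j \<and> j < m}"
    unfolding sum_square_split_diagonal by (subst sum_offdiag_symmetric) (auto simp: gap_energy_commute)
  also have "\<dots> \<le> (D1 + of_nat m * ennreal (1 + ln 2)) + 2 * ((D2 + of_nat m) + T)"
    by (intro add_mono diag mult_left_mono off) simp
  also have "\<dots> = (D1 + 2 * D2) + 2 * T + of_nat m * (ennreal (1 + ln 2) + 2)"
    by (simp only: distrib_left ac_simps)
  also have "\<dots> \<le> 2 * T + 2 * T + of_nat m * (ennreal (1 + ln 2) + 2)"
  proof (intro add_mono order_refl)
    have "D1 + 2 * D2 \<le> 2 * D1 + 2 * D2" by (intro add_right_mono) (simp add: mult_2)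
    also have "\<dots> = 2 * (D1 + D2)" by (simp only: distrib_left)
    also have "\<dots> \<le> 2 * T" by (intro mult_left_mono D12) simp
    finally show "D1 + 2 * D2 \<le> 2 * T" .
  qed
  also have "ennreal (1 + ln 2) + 2 = ennreal (3 + ln 2)"
  proof -
    have "ennreal ((1 + ln 2) + 2) = ennreal (1 + ln 2) + ennreal 2" by (rule ennreal_plus) auto
    moreover have "(1 + ln 2) + 2 = (3 + ln 2 :: real)" by linarith
    ultimately show ?thesis by (simp only: ennreal_numeral)
  qed
  also have "2 * T + 2 * T = 2 * (2 * T)" by (simp only: mult_2)
  also have "2 * T = (\<Sum>(i, j)\<in>{(i, j). i < Suc m \<and> j < Suc m \<and> i \<noteq> j}. K d (a i - a j))"
    unfolding T_def P_def by (rule sum_offdiag_symmetric[symmetric]) (simp add: K_minus_commute)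
  finally show ?thesis .
qed

definition normalized_field :: "(complex \<Rightarrow> complex) \<Rightarrow> nat \<Rightarrow> real \<Rightarrow> ennreal" where
  "normalized_field w n x = ennreal (Q w x) / of_nat n"

lemma of_nat_ennreal_bounds:
  assumes "n > 0"
  shows "(of_nat n :: ennreal) \<noteq> 0" "(of_nat n :: ennreal) \<noteq> \<top>" "(of_nat n :: ennreal) / of_nat n = 1"
  using assms by (auto intro!: ennreal_divide_self simp: less_top[symmetric])

lemma of_nat_mult_divide_cancel:
  "n > 0 \<Longrightarrow> of_nat n * (x / of_nat n) = (x :: ennreal)"
  using of_nat_ennreal_bounds[of n] by (metis ennreal_times_divide mult.commute mult_divide_eq_ennreal)

context
  fixes d :: real and w :: "complex \<Rightarrow> complex" and n :: nat
  assumes d: "d > 0" and wf: "weight_function d w" and n: "n \<ge> 2"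
begin

abbreviation "q \<equiv> normalized_field w n"

lemma n_pos: "n > 0" using n by simp

lemma of_nat_mult_q: "of_nat n * q x = ennreal (Q w x)"
  unfolding normalized_field_def by (rule of_nat_mult_divide_cancel[OF n_pos])

lemma Q_measurable [measurable]: "Q w \<in> borel_measurable borel"
  using Q_continuous[OF wf] by (rule borel_measurable_continuous_onI)

lemma q_measurable [measurable]: "q \<in> borel_measurable borel"
  unfolding normalized_field_def[abs_def] by measurable

lemma q_eq: "q x = ennreal (Q w x / real n)"
  using n Q_nonneg[OF wf, of x]
  by (simp add: normalized_field_def divide_ennreal[symmetric] ennreal_of_nat_eq_real_of_nat)

lemma q_seq_lsc: "seq_lsc q"
  unfolding seq_lsc_def
proof (intro allI impI)
  fix X x assume X: "X \<longlonglongrightarrow> (x::real)"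
  have "isCont (Q w) x" using Q_continuous[OF wf] by (simp add: continuous_on_eq_continuous_at)
  then have "(\<lambda>n. Q w (X n)) \<longlonglongrightarrow> Q w x" using X by (rule isCont_tendsto_compose)
  then have "(\<lambda>k. q (X k)) \<longlonglongrightarrow> q x" unfolding q_eq by (intro tendsto_intros) (use n in auto)
  then show "q x \<le> liminf (\<lambda>k. q (X k))" by (rule le_liminf_if_tendsto)
qed

lemma q_coercive: "\<exists>R. \<forall>x. q x \<le> ennreal C \<longrightarrow> \<bar>x\<bar> \<le> R"
proof -
  obtain R where R: "\<And>x. Q w x \<le> real n * \<bar>C\<bar> \<Longrightarrow> \<bar>x\<bar> \<le> R" using Q_coercive[OF d wf] by blast
  have "\<bar>x\<bar> \<le> R" if "q x \<le> ennreal C" for x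
  proof (rule R)
    have "ennreal (Q w x / real n) \<le> ennreal \<bar>C\<bar>"
      using that unfolding q_eq by (rule order_trans) (simp add: ennreal_leI)
    then have "Q w x / real n \<le> \<bar>C\<bar>" by simp
    then show "Q w x \<le> real n * \<bar>C\<bar>" using n by (simp add: field_simps)
  qed
  then show ?thesis by blast
qed

lemma energy_C_scaled:
  assumes mu: "sets \<mu> = sets borel" and P: "real_distribution P"
    and int: "\<And>f. f \<in> borel_measurable borel \<Longrightarrow> (\<integral>\<^sup>+x. f x \<partial>\<mu>) = of_nat n * (\<integral>\<^sup>+x. f x \<partial>P)"
  shows "energy_C d w \<mu> = of_nat n * (of_nat n * field_energy d q P)"
proof -
  interpret P: real_distribution P by fact
  note [measurable] = potential_measurable[OF P]
  have 1: "(\<integral>\<^sup>+x. K d (x - y) \<partial>\<mu>) = of_nat n * potential d P y" for y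
    unfolding potential_def by (subst int) (simp_all add: K_minus_commute)
  have 2: "(\<integral>\<^sup>+x. ennreal (Q w x) \<partial>\<mu>) = of_nat n * (of_nat n * (\<integral>\<^sup>+x. q x \<partial>P))"
    by (subst int) (simp_all add: of_nat_mult_q[symmetric] nn_integral_cmult)
  show ?thesis unfolding energy_C_def 1 2 field_energy_def mutual_energy_def
    by (subst int) (simp_all add: nn_integral_cmult distrib_left mult.left_commute)
qed

lemma scale_up:
  assumes "real_distribution P"
  shows "scale_measure (of_nat n) P \<in> borel_measures n"
    "f \<in> borel_measurable borel \<Longrightarrow> (\<integral>\<^sup>+x. f x \<partial>scale_measure (of_nat n) P) = of_nat n * (\<integral>\<^sup>+x. f x \<partial>P)"
proof -
  interpret real_distribution P by fact
  show "scale_measure (of_nat n) P \<in> borel_measures n"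
    using real_distributionD[OF assms] by (simp add: borel_measures_def space_scale_measure)
  show "f \<in> borel_measurable borel \<Longrightarrow> (\<integral>\<^sup>+x. f x \<partial>scale_measure (of_nat n) P) = of_nat n * (\<integral>\<^sup>+x. f x \<partial>P)"
    by (rule nn_integral_scale_measure) simp
qed

lemma scale_down:
  assumes "\<mu> \<in> borel_measures n"
  shows "\<exists>P. real_distribution P \<and> (\<forall>f. f \<in> borel_measurable borel \<longrightarrow> (\<integral>\<^sup>+x. f x \<partial>\<mu>) = of_nat n * (\<integral>\<^sup>+x. f x \<partial>P))"
proof -
  have mu: "sets \<mu> = sets borel" "emeasure \<mu> (space \<mu>) = of_nat n" using assms by (auto simp: borel_measures_def)
  let ?P = "scale_measure (1 / of_nat n) \<mu>"
  have "real_distribution ?P"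
  proof (rule real_distributionI)
    have "emeasure ?P (space ?P) = of_nat n * (1 / of_nat n)" using mu by (simp add: space_scale_measure mult.commute)
    also have "\<dots> = 1" by (rule of_nat_mult_divide_cancel[OF n_pos])
    finally show "prob_space ?P" by (rule prob_spaceI)
  qed (use mu in simp)
  moreover have "(\<integral>\<^sup>+x. f x \<partial>\<mu>) = of_nat n * (\<integral>\<^sup>+x. f x \<partial>?P)" if "f \<in> borel_measurable borel" for f
  proof -
    have "f \<in> borel_measurable \<mu>" using that mu by (simp cong: measurable_cong_sets)
    then have "of_nat n * (\<integral>\<^sup>+x. f x \<partial>?P) = of_nat n * (1 / of_nat n) * (\<integral>\<^sup>+x. f x \<partial>\<mu>)"
      by (simp add: nn_integral_scale_measure mult.assoc)
    also have "of_nat n * (1 / of_nat n) = (1::ennreal)" by (rule of_nat_mult_divide_cancel[OF n_pos])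
    finally show ?thesis by simp
  qed
  ultimately show ?thesis by blast
qed

text \<open>The uniform distribution on [0,1], which is the smeared measure of a single gap.\<close>

lemma finite_field_energy_exists:
  "\<exists>R. real_distribution R \<and> field_energy d q R < \<infinity>"
proof -
  obtain N where N: "real_distribution N" and int: "\<And>f. f \<in> borel_measurable borel \<Longrightarrow>
    (\<integral>\<^sup>+x. f x \<partial>N) = (\<Sum>i<1. \<integral>\<^sup>+s. f (smear real i s) \<partial>U01) / of_nat 1"
    using smeared_measure_exists[of 1 real] by auto
  have "mutual_energy d N N \<le> K d (real (Suc 0) - real 0) + ennreal (1 + ln 2)"
    using mutual_energy_smeared[where N=N and m=1 and a=real] N int gap_energy_self_le[OF d, of real 0]
    by (simp add: divide_ennreal_def)
  also have "\<dots> < \<infinity>" by (simp add: K_def)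
  finally have 1: "mutual_energy d N N < \<infinity>" .
  have "(\<integral>\<^sup>+x. q x \<partial>N) \<le> (\<integral>\<^sup>+x. ennreal (Q w x) \<partial>N)"
  proof (rule nn_integral_mono)
    show "q x \<le> ennreal (Q w x)" for x
      unfolding q_eq using n Q_nonneg[OF wf, of x] mult_right_mono[of 1 "real n" "Q w x"]
      by (intro ennreal_leI) (simp add: field_simps)
  qed
  also have "\<dots> = (\<integral>\<^sup>+s. ennreal (Q w (0 + s * (1 - 0))) \<partial>U01)"
    by (subst int) (simp_all add: smear_def divide_ennreal_def)
  also have "\<dots> \<le> 2 * \<dots>" by (simp add: mult_2)
  also have "\<dots> \<le> ennreal (Q w 0) + ennreal (Q w 1)" by (rule Q_average_le[OF wf])
  also have "\<dots> < \<infinity>" by simp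
  finally have "(\<integral>\<^sup>+x. q x \<partial>N) < \<infinity>" .
  with 1 N show ?thesis by (auto simp: field_energy_def ennreal_mult_less_top)
qed

lemma borel_measures_sets: "\<mu> \<in> borel_measures n \<Longrightarrow> sets \<mu> = sets borel"
  by (simp add: borel_measures_def)

lemma energy_C_scale_up:
  assumes "real_distribution R"
  shows "energy_C d w (scale_measure (of_nat n) R) = of_nat n * (of_nat n * field_energy d q R)"
  by (rule energy_C_scaled[OF borel_measures_sets[OF scale_up(1)[OF assms]] assms scale_up(2)[OF assms]])

lemma minimizer_C_exists:
  "\<exists>\<mu>0\<in>borel_measures n. \<forall>\<mu>\<in>borel_measures n. energy_C d w \<mu>0 \<le> energy_C d w \<mu>"
proof -
  obtain R0 where "real_distribution R0" "field_energy d q R0 < \<infinity>" using finite_field_energy_exists by blast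
  from field_energy_minimizer_exists[OF d q_seq_lsc q_coercive this]
  obtain P0 where P0: "real_distribution P0"
    "\<And>R. real_distribution R \<Longrightarrow> field_energy d q P0 \<le> field_energy d q R" by blast
  have "energy_C d w (scale_measure (of_nat n) P0) \<le> energy_C d w \<mu>" if \<mu>: "\<mu> \<in> borel_measures n" for \<mu>
  proof -
    obtain P where P: "real_distribution P" "\<And>f. f \<in> borel_measurable borel \<Longrightarrow> (\<integral>\<^sup>+x. f x \<partial>\<mu>) = of_nat n * (\<integral>\<^sup>+x. f x \<partial>P)"
      using scale_down[OF \<mu>] by blast
    have "energy_C d w \<mu> = of_nat n * (of_nat n * field_energy d q P)"
      by (rule energy_C_scaled[OF borel_measures_sets[OF \<mu>] P])
    then show ?thesis unfolding energy_C_scale_up[OF P0(1)] by (simp add: mult_left_mono P0(2) P(1))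
  qed
  then show ?thesis using scale_up(1)[OF P0(1)] by blast
qed

lemma minimizer_C_minimal:
  shows "minimizer_C d w n \<in> borel_measures n"
    and "\<And>\<mu>. \<mu> \<in> borel_measures n \<Longrightarrow> energy_C d w (minimizer_C d w n) \<le> energy_C d w \<mu>"
proof -
  have "\<exists>\<mu>. is_arg_min (energy_C d w) (\<lambda>\<mu>. \<mu> \<in> borel_measures n) \<mu>"
    using minimizer_C_exists by (auto simp: is_arg_min_def not_less)
  then have "is_arg_min (energy_C d w) (\<lambda>\<mu>. \<mu> \<in> borel_measures n) (minimizer_C d w n)"
    unfolding minimizer_C_def arg_min_def by (rule someI_ex)
  then show "minimizer_C d w n \<in> borel_measures n"
    and "\<And>\<mu>. \<mu> \<in> borel_measures n \<Longrightarrow> energy_C d w (minimizer_C d w n) \<le> energy_C d w \<mu>"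
    by (auto simp: is_arg_min_def not_less)
qed

text \<open>
  Passing from measures of mass n to probability measures multiplies the interaction by n^2 and turns
  the field Q into Q/n, so the minimizer of one problem is a multiple of a minimizer of the other.
\<close>

lemma F_C_normalized:
  "\<exists>P. real_distribution P \<and> field_energy d q P < \<infinity> \<and>
      (\<forall>R. real_distribution R \<longrightarrow> field_energy d q P \<le> field_energy d q R) \<and>
      F_C d w n = of_nat n * (of_nat n * (mutual_energy d P P + (\<integral>\<^sup>+x. q x \<partial>P)))"
proof -
  let ?\<mu> = "minimizer_C d w n"
  note mem = minimizer_C_minimal(1) and min = minimizer_C_minimal(2)
  obtain P where P: "real_distribution P" and int: "\<And>f. f \<in> borel_measurable borel \<Longrightarrow> (\<integral>\<^sup>+x. f x \<partial>?\<mu>) = of_nat n * (\<integral>\<^sup>+x. f x \<partial>P)"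
    using scale_down[OF mem] by blast
  interpret P: real_distribution P by fact
  have E: "energy_C d w ?\<mu> = of_nat n * (of_nat n * field_energy d q P)"
    by (rule energy_C_scaled[OF borel_measures_sets[OF mem] P int])
  have minP: "field_energy d q P \<le> field_energy d q R" if R: "real_distribution R" for R
    using min[OF scale_up(1)[OF R]] of_nat_ennreal_bounds[OF n_pos]
    unfolding E energy_C_scale_up[OF R] by (simp add: ennreal_mult_le_mult_iff)
  have fin: "field_energy d q P < \<infinity>"
    using finite_field_energy_exists minP by (meson le_less_trans)
  let ?q = "\<integral>\<^sup>+x. q x \<partial>P"
  have intQ: "(\<integral>\<^sup>+x. ennreal (Q w x) \<partial>?\<mu>) = of_nat n * (of_nat n * ?q)"
    by (subst int) (simp_all add: of_nat_mult_q[symmetric] nn_integral_cmult)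
  have "?q < \<top>" using fin by (auto simp: field_energy_def ennreal_mult_less_top)
  then have "of_nat n * (of_nat n * ?q) \<noteq> \<top>"
    using of_nat_ennreal_bounds[OF n_pos] by (simp add: ennreal_mult_eq_top_iff)
  then have "F_C d w n = of_nat n * (of_nat n * (mutual_energy d P P + ?q))"
    unfolding F_C_def E intQ field_energy_def mult_2 distrib_left add.assoc[symmetric]
    by (rule ennreal_add_diff_cancel_right)
  with P fin minP show ?thesis by blast
qed

text \<open>
  The sublevel set E of U^P + q at level f is closed by lower semicontinuity, bounded because q is
  coercive, and carries P by the Frostman condition. The competing potential is that of the uniform
  distribution on the points of the discrete minimizer.
\<close>

lemma F_D_le_F_C: "F_D d w n / of_nat (n - 1) \<le> F_C d w n / of_nat n"
proof -
  obtain P where P: "real_distribution P" and fin: "field_energy d q P < \<infinity>"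
    and min: "\<And>R. real_distribution R \<Longrightarrow> field_energy d q P \<le> field_energy d q R"
    and FC: "F_C d w n = of_nat n * (of_nat n * (mutual_energy d P P + (\<integral>\<^sup>+x. q x \<partial>P)))"
    using F_C_normalized by blast
  define f where "f = mutual_energy d P P + (\<integral>\<^sup>+x. q x \<partial>P)"
  have f: "f < \<infinity>" "mutual_energy d P P < \<infinity>"
    using fin by (auto simp: f_def field_energy_def ennreal_mult_less_top)
  define E where "E = {x. potential d P x + q x \<le> f}"
  have "compact E"
  proof -
    have "closed E" unfolding E_def
      by (rule closed_sublevel_seq_lsc[OF seq_lsc_add[OF potential_seq_lsc[OF d P] q_seq_lsc]])
    moreover obtain C where C: "f = ennreal C" using f by (cases f) auto
    obtain R where R: "\<And>x. q x \<le> ennreal C \<Longrightarrow> \<bar>x\<bar> \<le> R" using q_coercive by blast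
    have "bounded E" unfolding bounded_iff
    proof (intro exI[of _ R] ballI)
      fix x assume "x \<in> E"
      then have "q x \<le> f" unfolding E_def by (auto elim: order_trans[rotated])
      then show "norm x \<le> R" using R C by simp
    qed
    ultimately show ?thesis by (simp add: compact_eq_bounded_closed)
  qed
  have PE: "AE x in P. x \<in> E"
    using frostman_AE_le[OF P q_measurable fin] min by (simp add: E_def f_def)
  define S where "S = set (minimizer_D d w n)"
  have S: "finite S" "card S = n"
    using increasing_tuplesD[OF minimizer_D_minimal(1)[OF d wf n]] by (auto simp: S_def)
  then have S_ne: "S \<noteq> {}" using n by auto
  define N where "N = distr (measure_pmf (pmf_of_set S)) borel (\<lambda>x. x)"
  have N: "real_distribution N"
    unfolding N_def by (intro real_distributionI measure_pmf.prob_space_distr) auto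
  have potN: "potential d N x = (\<Sum>p\<in>S. K d (x - p)) / of_nat n" for x
    unfolding potential_def N_def using S S_ne by (simp add: nn_integral_distr nn_integral_pmf_of_set)
  define g where "g = F_D d w n / of_nat (n - 1) / of_nat n"
  have m: "n - 1 > 0" using n by simp
  have "g \<le> f"
  proof (rule potential_domination[OF d \<open>compact E\<close> q_measurable P PE f(2) N])
    show "potential d P x + q x \<le> f" if "x \<in> E" for x using that by (simp add: E_def)
    show "g \<le> potential d N x + q x" for x
    proof -
      have "F_D d w n / of_nat (n - 1) \<le> of_nat (n - 1) * ((\<Sum>p\<in>S. K d (x - p)) + ennreal (Q w x)) / of_nat (n - 1)"
        unfolding S_def by (intro divide_right_mono_ennreal F_D_le_potential[OF d wf n])
      also have "\<dots> = (\<Sum>p\<in>S. K d (x - p)) + ennreal (Q w x)"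
        using of_nat_mult_divide_cancel[OF m] by (simp add: ennreal_times_divide)
      finally have "g \<le> ((\<Sum>p\<in>S. K d (x - p)) + ennreal (Q w x)) / of_nat n"
        unfolding g_def by (rule divide_right_mono_ennreal)
      then show ?thesis by (simp add: potN normalized_field_def divide_ennreal_def distrib_right)
    qed
  qed
  then have "of_nat n * g \<le> of_nat n * f" by (rule mult_left_mono) simp
  moreover have "F_C d w n / of_nat n = of_nat n * f"
    unfolding FC f_def[symmetric] using of_nat_mult_divide_cancel[OF n_pos, of "of_nat n * f"]
    by (simp add: ennreal_times_divide)
  ultimately show ?thesis unfolding g_def by (simp add: of_nat_mult_divide_cancel[OF n_pos])
qed

lemma F_C_le_energy:
  assumes "real_distribution N"
  shows "F_C d w n \<le> of_nat n * (of_nat n * field_energy d q N)"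
proof -
  have "F_C d w n \<le> energy_C d w (minimizer_C d w n)" unfolding F_C_def by (rule diff_le_self_ennreal)
  also have "\<dots> \<le> energy_C d w (scale_measure (of_nat n) N)"
    by (rule minimizer_C_minimal(2)[OF scale_up(1)[OF assms]])
  also have "\<dots> = of_nat n * (of_nat n * field_energy d q N)"
    by (rule energy_C_scale_up[OF assms])
  finally show ?thesis .
qed

text \<open>
  The trial measure is n times the smeared measure of the discrete minimizer. Its m = n - 1 gaps carry
  mass n/m each, whence the factor (n/m)^2 in front of the interaction.
\<close>

lemma F_C_le_F_D:
  "F_C d w n / of_nat n \<le> of_nat n / of_nat (n - 1) * (2 * F_D d w n / of_nat (n - 1) + ennreal (3 + ln 2))"
proof -
  define m where "m = n - 1"
  have m: "m > 0" "n = Suc m" using n by (auto simp: m_def)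
  let ?l = "minimizer_D d w n"
  define a where "a = (!) ?l"
  note D = increasing_tuplesD[OF minimizer_D_minimal(1)[OF d wf n]]
  have inc: "a i < a j" if "i < j" "j \<le> m" for i j
    using minimizer_D_minimal(1)[OF d wf n] that m(2)
    by (auto simp: a_def increasing_tuples_def sorted_wrt_iff_nth_less)
  let ?KS = "\<Sum>(i, j)\<in>{(i, j). i < Suc m \<and> j < Suc m \<and> i \<noteq> j}. K d (a i - a j)"
  let ?QS = "\<Sum>i<Suc m. ennreal (Q w (a i))"
  have FD: "F_D d w n = ?KS + ennreal (real m / real n) * ?QS"
    unfolding F_D_eq[OF d wf n] point_energy_def a_def m_def[symmetric]
    using sum_pairs_list[OF D(1,2), of "\<lambda>x y. K d (x - y)"] sum_nth_eq_sum_set[OF D(1,2), of "\<lambda>x. ennreal (Q w x)"]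
    by (simp add: m(2))
  obtain N where N: "real_distribution N" and int: "\<And>f. f \<in> borel_measurable borel \<Longrightarrow>
    (\<integral>\<^sup>+x. f x \<partial>N) = (\<Sum>i<m. \<integral>\<^sup>+s. f (smear a i s) \<partial>U01) / of_nat m"
    using smeared_measure_exists[OF m(1), of a] by auto
  interpret N: real_distribution N by fact
  have mutual: "of_nat m * (of_nat m * mutual_energy d N N) \<le> 2 * ?KS + of_nat m * ennreal (3 + ln 2)"
  proof -
    have "of_nat m * (of_nat m * mutual_energy d N N) = (\<Sum>i<m. \<Sum>j<m. gap_energy d a i j)"
    proof -
      have "mutual_energy d N N = (\<Sum>i<m. \<Sum>j<m. gap_energy d a i j) / of_nat m / of_nat m"
        by (rule mutual_energy_smeared[OF N int])
      then show ?thesis by (simp only: of_nat_mult_divide_cancel[OF m(1)])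
    qed
    then show ?thesis using gap_energy_sum_le[OF d m(1), of a] inc by simp
  qed
  have field: "2 * (of_nat m * (\<integral>\<^sup>+x. ennreal (Q w x) \<partial>N)) \<le> 2 * ?QS"
  proof -
    have "of_nat m * (\<integral>\<^sup>+x. ennreal (Q w x) \<partial>N) = (\<Sum>i<m. \<integral>\<^sup>+s. ennreal (Q w (smear a i s)) \<partial>U01)"
      by (subst int) (simp_all add: of_nat_mult_divide_cancel[OF m(1)])
    then have "2 * (of_nat m * (\<integral>\<^sup>+x. ennreal (Q w x) \<partial>N)) = (\<Sum>i<m. 2 * (\<integral>\<^sup>+s. ennreal (Q w (smear a i s)) \<partial>U01))"
      by (simp add: sum_distrib_left)
    also have "\<dots> \<le> (\<Sum>i<m. ennreal (Q w (a i)) + ennreal (Q w (a (Suc i))))"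
      unfolding smear_def by (intro sum_mono Q_average_le[OF wf])
    also have "\<dots> = (\<Sum>i<m. ennreal (Q w (a i))) + (\<Sum>i<m. ennreal (Q w (a (Suc i))))" by (rule sum.distrib)
    also have "\<dots> \<le> ?QS + ?QS"
    proof (rule add_mono)
      show "(\<Sum>i<m. ennreal (Q w (a i))) \<le> ?QS" by simp
      show "(\<Sum>i<m. ennreal (Q w (a (Suc i)))) \<le> ?QS" unfolding sum.lessThan_Suc_shift by simp
    qed
    finally show ?thesis by (simp only: mult_2)
  qed
  have nmu: "of_nat n * (\<integral>\<^sup>+x. q x \<partial>N) = (\<integral>\<^sup>+x. ennreal (Q w x) \<partial>N)"
    using real_distributionD[OF N] by (simp add: of_nat_mult_q[symmetric] nn_integral_cmult)
  let ?n = "of_nat n :: ennreal" and ?m = "of_nat m :: ennreal"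
  have "?m * (?m * (?n * field_energy d q N)) =
      ?n * (?m * (?m * mutual_energy d N N)) + ?m * (2 * (?m * (?n * (\<integral>\<^sup>+x. q x \<partial>N))))"
    unfolding field_energy_def by (simp only: distrib_left ac_simps)
  also have "\<dots> \<le> ?n * (2 * ?KS + ?m * ennreal (3 + ln 2)) + ?m * (2 * ?QS)"
    unfolding nmu by (intro add_mono mult_left_mono mutual field) auto
  also have "?m * (2 * ?QS) = ?n * (2 * (ennreal (real m / real n) * ?QS))"
  proof -
    have "?m = ?n * ennreal (real m / real n)"
      using n by (simp add: ennreal_of_nat_eq_real_of_nat ennreal_mult[symmetric])
    then show ?thesis by (simp only: ac_simps)
  qed
  also have "?n * (2 * ?KS + ?m * ennreal (3 + ln 2)) + \<dots> = ?n * (2 * F_D d w n + ?m * ennreal (3 + ln 2))"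
    unfolding FD by (simp only: distrib_left ac_simps)
  finally have key: "?m * (?m * (?n * field_energy d q N)) \<le> ?n * (2 * F_D d w n + ?m * ennreal (3 + ln 2))" .
  have "F_C d w n / ?n \<le> ?n * (?n * field_energy d q N) / ?n"
    by (intro divide_right_mono_ennreal F_C_le_energy N)
  also have "\<dots> = ?n * field_energy d q N"
    using of_nat_mult_divide_cancel[OF n_pos] by (simp add: ennreal_times_divide)
  also have "\<dots> = ?m * (?m * (?n * field_energy d q N)) / ?m / ?m"
    using of_nat_mult_divide_cancel[OF m(1)] by (simp add: ennreal_times_divide)
  also have "\<dots> \<le> ?n * (2 * F_D d w n + ?m * ennreal (3 + ln 2)) / ?m / ?m"
    by (intro divide_right_mono_ennreal key)
  also have "\<dots> = ?n / ?m * ((2 * F_D d w n + ?m * ennreal (3 + ln 2)) / ?m)"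
    by (simp add: divide_ennreal_def ac_simps)
  also have "(2 * F_D d w n + ?m * ennreal (3 + ln 2)) / ?m = 2 * F_D d w n / ?m + ennreal (3 + ln 2)"
  proof -
    have "?m * ennreal (3 + ln 2) / ?m = ennreal (3 + ln 2)"
      using of_nat_mult_divide_cancel[OF m(1)] by (simp only: ennreal_times_divide)
    moreover have "(2 * F_D d w n + ?m * ennreal (3 + ln 2)) / ?m = 2 * F_D d w n / ?m + ?m * ennreal (3 + ln 2) / ?m"
      by (simp only: divide_ennreal_def distrib_right)
    ultimately show ?thesis by (simp only:)
  qed
  finally show ?thesis unfolding m_def .
qed

end

theorem theorem2p3:
  fixes d :: real and w :: "complex \<Rightarrow> complex" and n :: nat
  assumes "d > 0" and "weight_function d w" and "n \<ge> 2"
  shows "F_D d w n / of_nat (n - 1) \<le> F_C d w n / of_nat n \<and>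
         F_C d w n / of_nat n \<le>
           of_nat n / of_nat (n - 1) * (2 * F_D d w n / of_nat (n - 1) + ennreal (3 + ln 2))"
  using F_D_le_F_C[OF assms] F_C_le_F_D[OF assms] by blast

end
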